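(* Let $\mathcal X=\{x_{n,k}\}$ be a Marcinkiewicz–Zygmund family on $\mathbb T$ with weights $\tau_{n,k}$ and constants $A,B>0$, let $\kappa=B/A$, and let $I_n$ be the associated quadrature rules (as in the context); write $I(f)=\int_{-1/2}^{1/2}f(x)\,dx$. (i) If $f\in C(\mathbb T)$, then $|I(f)-I_n(f)|\le(1+\sqrt\kappa)\inf_{p\in\mathcal T_n}\|f-p\|_\infty$. Consequently, if $f\in C^\sigma(\mathbb T)$, then $|I(f)-I_n(f)|=\mathcal O(n^{-\sigma})$. (ii) If $f\in H^\sigma(\mathbb T)$ with $\sigma>1/2$, then $|I(f)-I_n(f)|\le(1+\sqrt\kappa)\|f\|_{H^\sigma}\phi_\sigma(n)$ with $\phi_\sigma(n)=(\sigma-1/2)^{-1/2}n^{-\sigma+1/2}$. (iii) If $f$ extends to an analytic function on a strip $\{z\in\mathbb C:|\operatorname{Im}z|<\rho_0\}$, then for every $\rho<\rho_0$, $|I(f)-I_n(f)|=\mathcal O(e^{-\rho n})$.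
   Context: $\mathbb T=\mathbb R/\mathbb Z\cong(-1/2,1/2]$ with Lebesgue measure; $\langle f,g\rangle=\int_{-1/2}^{1/2}f\bar g\,dx$. $\mathcal T_n$ = trigonometric polynomials $\sum_{|k|\le n}c_ke^{2\pi ikx}$. $H^\sigma(\mathbb T)$ = functions with $\|f\|_{H^\sigma}^2=\sum_{k\in\mathbb Z}|\hat f(k)|^2(1+k^2)^\sigma<\infty$, $\hat f(k)=\int_0^1f(x)e^{-2\pi ikx}dx$. $C^\sigma(\mathbb T)$ denotes the standard space of functions of smoothness order $\sigma$ on $\mathbb T$. A Marcinkiewicz–Zygmund family is a set $\{x_{n,k}: n\in\mathbb N,k=1,\dots,L_n\}\subseteq\mathbb T$ with weights $\tau_{n,k}>0$ and constants $A,B>0$ independent of $n$ such that $A\|p\|_2^2\le\sum_{k=1}^{L_n}|p(x_{n,k})|^2\tau_{n,k}\le B\|p\|_2^2$ for all $p\in\mathcal T_n$. Let $k^{(n)}_x$ be the reproducing kernel of $\mathcal T_n$ ($p(x)=\langle p,k^{(n)}_x\rangle$, $p\in\mathcal T_n$), $S_np=\sum_{k=1}^{L_n}\tau_{n,k}\langle p,k^{(n)}_{x_{n,k}}\rangle k^{(n)}_{x_{n,k}}$ on $\mathcal T_n$, $e_{n,k}=S_n^{-1}(\tau_{n,k}^{1/2}k^{(n)}_{x_{n,k}})$, $w_{n,k}=\tau_{n,k}^{1/2}\int_{-1/2}^{1/2}e_{n,k}(x)dx$, and $I_n(f)=\sum_{k=1}^{L_n}f(x_{n,k})w_{n,k}$.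 *)

theory Defs
  imports "HOL-Analysis.Analysis" "HOL-Library.Landau_Symbols"
begin

text \<open>Functions on the torus are 1-periodic functions real => complex.
  Integrals are over [-1/2,1/2].\<close>

definition periodic1 :: "(real \<Rightarrow> complex) \<Rightarrow> bool" where
  "periodic1 f \<longleftrightarrow> (\<forall>t. f (t + 1) = f t)"

definition trig_poly :: "nat \<Rightarrow> (real \<Rightarrow> complex) \<Rightarrow> bool" where
  "trig_poly n p \<longleftrightarrow> (\<exists>c :: int \<Rightarrow> complex.
     p = (\<lambda>t. \<Sum>k\<in>{- int n..int n}. c k * exp (2 * pi * \<i> * of_int k * of_real t)))"

definition l2inner :: "(real \<Rightarrow> complex) \<Rightarrow> (real \<Rightarrow> complex) \<Rightarrow> complex" where
  "l2inner f g = integral {-1/2..1/2} (\<lambda>t. f t * cnj (g t))"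

definition l2norm :: "(real \<Rightarrow> complex) \<Rightarrow> real" where
  "l2norm f = sqrt (integral {-1/2..1/2} (\<lambda>t. (cmod (f t))\<^sup>2))"

definition repkernel :: "nat \<Rightarrow> real \<Rightarrow> (real \<Rightarrow> complex)" where
  "repkernel n y = (THE k. trig_poly n k \<and> (\<forall>p. trig_poly n p \<longrightarrow> p y = l2inner p k))"

definition S_op :: "(nat \<Rightarrow> nat) \<Rightarrow> (nat \<Rightarrow> nat \<Rightarrow> real) \<Rightarrow> (nat \<Rightarrow> nat \<Rightarrow> real)
    \<Rightarrow> nat \<Rightarrow> (real \<Rightarrow> complex) \<Rightarrow> (real \<Rightarrow> complex)" where
  "S_op L x \<tau> n p = (\<lambda>t. \<Sum>k=1..L n. complex_of_real (\<tau> n k)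
       * l2inner p (repkernel n (x n k)) * repkernel n (x n k) t)"

definition e_fun :: "(nat \<Rightarrow> nat) \<Rightarrow> (nat \<Rightarrow> nat \<Rightarrow> real) \<Rightarrow> (nat \<Rightarrow> nat \<Rightarrow> real)
    \<Rightarrow> nat \<Rightarrow> nat \<Rightarrow> (real \<Rightarrow> complex)" where
  "e_fun L x \<tau> n k = (THE e. trig_poly n e \<and>
     S_op L x \<tau> n e = (\<lambda>t. complex_of_real (sqrt (\<tau> n k)) * repkernel n (x n k) t))"

definition qweight :: "(nat \<Rightarrow> nat) \<Rightarrow> (nat \<Rightarrow> nat \<Rightarrow> real) \<Rightarrow> (nat \<Rightarrow> nat \<Rightarrow> real)
    \<Rightarrow> nat \<Rightarrow> nat \<Rightarrow> complex" where
  "qweight L x \<tau> n k = complex_of_real (sqrt (\<tau> n k)) * integral {-1/2..1/2} (e_fun L x \<tau> n k)"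

definition quad :: "(nat \<Rightarrow> nat) \<Rightarrow> (nat \<Rightarrow> nat \<Rightarrow> real) \<Rightarrow> (nat \<Rightarrow> nat \<Rightarrow> real)
    \<Rightarrow> nat \<Rightarrow> (real \<Rightarrow> complex) \<Rightarrow> complex" where
  "quad L x \<tau> n f = (\<Sum>k=1..L n. f (x n k) * qweight L x \<tau> n k)"

definition MZ_family :: "(nat \<Rightarrow> nat) \<Rightarrow> (nat \<Rightarrow> nat \<Rightarrow> real) \<Rightarrow> (nat \<Rightarrow> nat \<Rightarrow> real)
    \<Rightarrow> real \<Rightarrow> real \<Rightarrow> bool" where
  "MZ_family L x \<tau> A B \<longleftrightarrow> 0 < A \<and> 0 < B \<and>
     (\<forall>n\<ge>1. \<forall>k\<in>{1..L n}. 0 < \<tau> n k \<and> x n k \<in> {-1/2<..1/2}) \<and>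
     (\<forall>n\<ge>1. \<forall>p. trig_poly n p \<longrightarrow>
        A * (l2norm p)\<^sup>2 \<le> (\<Sum>k=1..L n. (cmod (p (x n k)))\<^sup>2 * \<tau> n k) \<and>
        (\<Sum>k=1..L n. (cmod (p (x n k)))\<^sup>2 * \<tau> n k) \<le> B * (l2norm p)\<^sup>2)"

definition sup_norm :: "(real \<Rightarrow> complex) \<Rightarrow> real" where
  "sup_norm g = Sup (range (\<lambda>t. cmod (g t)))"

definition best_approx :: "nat \<Rightarrow> (real \<Rightarrow> complex) \<Rightarrow> real" where
  "best_approx n f = Inf {sup_norm (\<lambda>t. f t - p t) | p. trig_poly n p}"

definition C_sigma :: "real \<Rightarrow> (real \<Rightarrow> complex) \<Rightarrow> bool" where
  "C_sigma \<sigma> f \<longleftrightarrow> periodic1 f \<and>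
     (\<exists>D :: nat \<Rightarrow> real \<Rightarrow> complex. D 0 = f \<and>
        (\<forall>j<nat \<lfloor>\<sigma>\<rfloor>. \<forall>t. (D j has_vector_derivative D (Suc j) t) (at t)) \<and>
        continuous_on UNIV (D (nat \<lfloor>\<sigma>\<rfloor>)) \<and>
        (\<sigma> - of_int \<lfloor>\<sigma>\<rfloor> > 0 \<longrightarrow>
           (\<exists>M. \<forall>s t. cmod (D (nat \<lfloor>\<sigma>\<rfloor>) s - D (nat \<lfloor>\<sigma>\<rfloor>) t)
                     \<le> M * \<bar>s - t\<bar> powr (\<sigma> - of_int \<lfloor>\<sigma>\<rfloor>))))"

definition fourier_coeff :: "(real \<Rightarrow> complex) \<Rightarrow> int \<Rightarrow> complex" where
  "fourier_coeff f k = integral {0..1} (\<lambda>t. f t * exp (- 2 * pi * \<i> * of_int k * of_real t))"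

definition in_H_sigma :: "real \<Rightarrow> (real \<Rightarrow> complex) \<Rightarrow> bool" where
  "in_H_sigma \<sigma> f \<longleftrightarrow>
     (\<lambda>k::int. (cmod (fourier_coeff f k))\<^sup>2 * (1 + (of_int k)\<^sup>2) powr \<sigma>) summable_on UNIV"

definition H_sigma_norm :: "real \<Rightarrow> (real \<Rightarrow> complex) \<Rightarrow> real" where
  "H_sigma_norm \<sigma> f =
     sqrt (\<Sum>\<^sub>\<infinity>k::int. (cmod (fourier_coeff f k))\<^sup>2 * (1 + (of_int k)\<^sup>2) powr \<sigma>)"

definition phi_sigma :: "real \<Rightarrow> nat \<Rightarrow> real" where
  "phi_sigma \<sigma> n = (\<sigma> - 1/2) powr (-1/2) * real n powr (- \<sigma> + 1/2)"

end

theory Submission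
  imports Defs "HOL-Complex_Analysis.Conformal_Mappings"
begin

text \<open>
  Let \<open>q\<close> be the trigonometric polynomial with \<open>S\<^sub>n q = 1\<close>. Self-adjointness of \<open>S\<^sub>n\<close> gives
  \<open>w\<^sub>n\<^sub>,\<^sub>k = \<tau>\<^sub>n\<^sub>,\<^sub>k cnj (q (x\<^sub>n\<^sub>,\<^sub>k))\<close>, so the rule is exact on trigonometric polynomials of degree
  \<open>n\<close>, and the Cauchy--Schwarz inequality with the Marcinkiewicz--Zygmund bounds yields
  \<open>\<Sum>\<^sub>k |w\<^sub>n\<^sub>,\<^sub>k| \<le> sqrt (B / A)\<close>. Hence the error is at most \<open>1 + sqrt (B / A)\<close> times the uniform
  distance of \<open>f\<close> to any such polynomial, and it remains to bound best approximations:
  for smooth \<open>f\<close> by Jackson's theorem, obtained by convolution with a positive kernel of second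
  moment \<open>O(n\<^sup>-\<^sup>2)\<close>; for Sobolev and analytic \<open>f\<close> by the tail of the Fourier coefficients.
\<close>

section \<open>Characters and trigonometric polynomials\<close>

text \<open>The kernels and the functions \<open>e_fun\<close> are given by \<open>THE\<close>, so
  nothing can be said about the weights before existence and uniqueness are settled. The lower
  Marcinkiewicz-Zygmund bound makes the operator injective, and finite dimension makes it bijective.

  All approximation results rest on one hypothesis, |f(y) - f(t)| \<le> a + b |1 - e(y - t)|^2. The
  chord |1 - e(u)| stands in for the distance on the torus because its square is a trigonometric
  polynomial, so its integral against the kernel is a finite sum. Hoelder continuity supplies the
  hypothesis with a of order n^(-\<alpha>) and b of order n^(2-\<alpha>). Plain continuity supplies
  it with a as small as desired and some fixed b, whose contribution vanishes as the degree of the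
  kernel grows.

  The Fejer kernel would not do: its constant coefficients jump at both ends, so its second moment
  is only of order 1/N. Parabolic coefficients vanish at the ends. Order N^(-2) gives the rate 1/n
  for Lipschitz functions without a logarithm, so the gain can be repeated once per
  derivative.\<close>

definition echar :: "int \<Rightarrow> real \<Rightarrow> complex" where
  "echar k t = cis (2 * pi * of_int k * t)"

lemma echar_exp: "exp (2 * pi * \<i> * of_int k * of_real t) = echar k t"
  by (simp add: echar_def cis_conv_exp mult_ac)

lemma echar_exp_minus: "exp (- 2 * pi * \<i> * of_int k * of_real t) = echar (-k) t"
  by (simp add: echar_def cis_conv_exp mult_ac)

lemma echar_0 [simp]: "echar 0 t = 1"
  by (simp add: echar_def)

lemma echar_mult: "echar k t * echar l t = echar (k + l) t"
  by (simp add: echar_def cis_mult algebra_simps)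

lemma echar_diff_arg: "echar k (s - t) = echar k s * echar (-k) t"
  by (simp add: echar_def cis_mult algebra_simps)

lemma cnj_echar: "cnj (echar k t) = echar (-k) t"
  by (simp add: echar_def cis_cnj)

lemma norm_echar [simp]: "cmod (echar k t) = 1"
  by (simp add: echar_def)

lemma echar_int: "echar k (of_int m) = 1"
proof -
  have "echar k (of_int m) = cis (2 * pi * of_int (k * m))"
    by (simp add: echar_def mult_ac)
  then show ?thesis by (metis cis_multiple_2pi Ints_of_int)
qed

lemma echar_diff_int: "echar k (t - of_int m) = echar k t"
  using echar_int[of "-k" m] by (simp add: echar_diff_arg)

lemma echar_plus_one: "echar k (t + 1) = echar k t"
  using echar_diff_int[of k t "-1"] by simp

lemma continuous_on_echar [continuous_intros]:
  "continuous_on S g \<Longrightarrow> continuous_on S (\<lambda>t. echar k (g t))"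
  unfolding echar_def by (intro continuous_intros)

lemma has_vector_derivative_echar:
  "(echar k has_vector_derivative (2 * pi * \<i> * of_int k * echar k t)) (at t within S)"
proof -
  have "((\<lambda>t. exp (2 * pi * \<i> * of_int k * of_real t)) has_vector_derivative
     (2 * pi * \<i> * of_int k * exp (2 * pi * \<i> * of_int k * of_real t))) (at t within S)"
    by (rule has_vector_derivative_real_field) (auto intro!: derivative_eq_intros)
  then show ?thesis unfolding echar_exp .
qed

text \<open>The free endpoint \<open>a\<close> serves both normalizations in use: inner products
  live on [-1/2, 1/2], Fourier coefficients and convolutions on [0, 1].\<close>

lemma has_integral_echar:
  "(echar k has_integral (if k = 0 then 1 else 0)) {a..a+1}"
proof (cases "k = 0")
  case True
  then have "echar k = (\<lambda>t. 1)" by auto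
  then show ?thesis using True has_integral_const_real[of "1::complex" a "a+1"] by simp
next
  case False
  let ?c = "2 * pi * \<i> * of_int k :: complex"
  have c: "?c \<noteq> 0" using False by simp
  have "((\<lambda>t. ?c * echar k t) has_integral (echar k (a+1) - echar k a)) {a..a+1}"
    by (rule fundamental_theorem_of_calculus) (use has_vector_derivative_echar[of k] in \<open>simp_all\<close>)
  then have "((\<lambda>t. ?c * echar k t) has_integral 0) {a..a+1}" by (simp add: echar_plus_one)
  from has_integral_mult_right[OF this, of "inverse ?c"] c False
  show ?thesis by (simp add: field_simps)
qed

lemma has_integral_echar_sums:
  assumes "finite I"
  shows "((\<lambda>t. (\<Sum>k\<in>I. c k * echar k t) * cnj (\<Sum>k\<in>I. d k * echar k t))
           has_integral (\<Sum>k\<in>I. c k * cnj (d k))) {a..a+1}"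
proof -
  have "((\<lambda>t. \<Sum>k\<in>I. \<Sum>l\<in>I. (c k * cnj (d l)) * echar (k - l) t) has_integral
      (\<Sum>k\<in>I. \<Sum>l\<in>I. (c k * cnj (d l)) * (if k - l = 0 then 1 else 0))) {a..a+1}"
    using assms by (intro has_integral_sum has_integral_mult_right has_integral_echar) auto
  moreover have "(\<Sum>k\<in>I. c k * echar k t) * cnj (\<Sum>k\<in>I. d k * echar k t)
      = (\<Sum>k\<in>I. \<Sum>l\<in>I. (c k * cnj (d l)) * echar (k - l) t)" for t
    by (simp add: sum_product cnj_echar mult_ac echar_mult[of k t "- l" for k l, simplified, symmetric])
  moreover have "(\<Sum>k\<in>I. \<Sum>l\<in>I. (c k * cnj (d l)) * (if k - l = 0 then 1 else 0)) = (\<Sum>k\<in>I. c k * cnj (d k))"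
    by (intro sum.cong refl) (use assms in \<open>simp add: if_distrib if_distribR cong: if_cong\<close>)
  ultimately show ?thesis by simp
qed

lemma has_integral_norm2_echar_sum:
  assumes "finite I"
  shows "((\<lambda>t. (cmod (\<Sum>k\<in>I. c k * echar k t))\<^sup>2) has_integral (\<Sum>k\<in>I. (cmod (c k))\<^sup>2)) {a..a+1}"
proof -
  have "((\<lambda>t. complex_of_real ((cmod (\<Sum>k\<in>I. c k * echar k t))\<^sup>2)) has_integral
      complex_of_real (\<Sum>k\<in>I. (cmod (c k))\<^sup>2)) {a..a+1}"
    using has_integral_echar_sums[OF assms, of c c a]
    by (simp only: complex_norm_square of_real_sum)
  from has_integral_linear[OF this bounded_linear_Re] show ?thesis by (simp add: o_def)
qed

lemma trig_poly_echar:
  "trig_poly n p \<longleftrightarrow> (\<exists>c. p = (\<lambda>t. \<Sum>k\<in>{- int n..int n}. c k * echar k t))"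
  unfolding trig_poly_def echar_exp ..

lemma trig_polyE:
  assumes "trig_poly n p"
  obtains c where "p = (\<lambda>t. \<Sum>k\<in>{- int n..int n}. c k * echar k t)"
  using assms trig_poly_echar by blast

lemma trig_poly_echar_sum: "trig_poly n (\<lambda>t. \<Sum>k\<in>{- int n..int n}. c k * echar k t)"
  unfolding trig_poly_echar by (rule exI[of _ c]) (rule refl)

lemma trig_poly_zero [simp]: "trig_poly n (\<lambda>t. 0)"
  unfolding trig_poly_echar by (intro exI[of _ "\<lambda>k. 0"]) simp

lemma trig_poly_add:
  assumes "trig_poly n p" "trig_poly n q"
  shows "trig_poly n (\<lambda>t. p t + q t)"
proof -
  from assms obtain c d where "p = (\<lambda>t. \<Sum>k\<in>{- int n..int n}. c k * echar k t)"
    "q = (\<lambda>t. \<Sum>k\<in>{- int n..int n}. d k * echar k t)" unfolding trig_poly_echar by blast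
  then show ?thesis unfolding trig_poly_echar
    by (intro exI[of _ "\<lambda>k. c k + d k"]) (simp add: algebra_simps sum.distrib)
qed

lemma trig_poly_cmult:
  assumes "trig_poly n p"
  shows "trig_poly n (\<lambda>t. a * p t)"
proof -
  from assms obtain c where "p = (\<lambda>t. \<Sum>k\<in>{- int n..int n}. c k * echar k t)"
    unfolding trig_poly_echar by blast
  then show ?thesis unfolding trig_poly_echar
    by (intro exI[of _ "\<lambda>k. a * c k"]) (simp add: sum_distrib_left mult_ac)
qed

lemma trig_poly_diff:
  assumes "trig_poly n p" "trig_poly n q"
  shows "trig_poly n (\<lambda>t. p t - q t)"
  using trig_poly_add[OF assms(1) trig_poly_cmult[OF assms(2), of "-1"]] by simp

lemma trig_poly_sum:
  assumes "\<And>i. i \<in> I \<Longrightarrow> trig_poly n (p i)"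
  shows "trig_poly n (\<lambda>t. \<Sum>i\<in>I. p i t)"
  using assms by (induction I rule: infinite_finite_induct) (auto intro: trig_poly_add)

lemma trig_poly_echarI:
  assumes "\<bar>k\<bar> \<le> int n"
  shows "trig_poly n (echar k)"
  unfolding trig_poly_echar
proof (intro exI ext)
  fix t
  have "(\<Sum>j\<in>{- int n..int n}. (if j = k then 1 else 0) * echar j t)
      = (\<Sum>j\<in>{- int n..int n}. if j = k then echar j t else 0)"
    by (intro sum.cong) auto
  then show "echar k t = (\<Sum>j\<in>{- int n..int n}. (if j = k then 1 else 0) * echar j t)"
    using assms by auto
qed

lemma trig_poly_const: "trig_poly n (\<lambda>t. a)"
  using trig_poly_cmult[OF trig_poly_echarI[of 0 n], of a] by simp

lemma continuous_on_trig_poly: "trig_poly n p \<Longrightarrow> continuous_on S p"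
  by (elim trig_polyE) (auto intro!: continuous_intros)

lemma trig_poly_plus_one: "trig_poly n p \<Longrightarrow> p (t + 1) = p t"
  by (elim trig_polyE) (simp add: echar_plus_one)

lemma l2inner_echar_sums:
  "l2inner (\<lambda>t. \<Sum>k\<in>{- int n..int n}. c k * echar k t) (\<lambda>t. \<Sum>k\<in>{- int n..int n}. d k * echar k t)
     = (\<Sum>k\<in>{- int n..int n}. c k * cnj (d k))"
  unfolding l2inner_def
  by (rule integral_unique) (use has_integral_echar_sums[of "{- int n..int n}" c d "-1/2"] in simp)

lemma l2norm_echar_sum:
  "(l2norm (\<lambda>t. \<Sum>k\<in>{- int n..int n}. c k * echar k t))\<^sup>2 = (\<Sum>k\<in>{- int n..int n}. (cmod (c k))\<^sup>2)"
proof -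
  have "integral {-1/2..1/2} (\<lambda>t. (cmod (\<Sum>k\<in>{- int n..int n}. c k * echar k t))\<^sup>2)
      = (\<Sum>k\<in>{- int n..int n}. (cmod (c k))\<^sup>2)"
    by (rule integral_unique) (use has_integral_norm2_echar_sum[of "{- int n..int n}" c "-1/2"] in simp)
  then show ?thesis unfolding l2norm_def by (simp add: sum_nonneg)
qed

lemma l2inner_add_left:
  assumes "continuous_on UNIV f" "continuous_on UNIV g" "continuous_on UNIV h"
  shows "l2inner (\<lambda>t. f t + g t) h = l2inner f h + l2inner g h"
proof -
  have "continuous_on {-1/2..1/2} f" "continuous_on {-1/2..1/2} g" "continuous_on {-1/2..1/2} h"
    using assms continuous_on_subset by blast+
  then show ?thesis unfolding l2inner_def
    by (simp add: distrib_right)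
       (intro Henstock_Kurzweil_Integration.integral_add integrable_continuous_interval continuous_intros)
qed

lemma l2inner_cmult_left: "l2inner (\<lambda>t. a * f t) h = a * l2inner f h"
  unfolding l2inner_def by (simp add: mult.assoc)

lemma cnj_l2inner: "cnj (l2inner f g) = l2inner g f"
  unfolding l2inner_def by (simp add: integral_cnj mult.commute)

section \<open>Exactness and stability of the quadrature rule\<close>

text \<open>Gaussian elimination, one column per induction step. Rows and columns are indexed by
  arbitrary finite sets because the size needed later, 2n + 1, varies with n.\<close>

lemma solve_injective_linear_system:
  fixes M :: "'a \<Rightarrow> 'b \<Rightarrow> 'f::field"
  assumes "finite J" "finite I" "card I = card J"
    and "\<And>c. (\<And>i. i \<in> I \<Longrightarrow> (\<Sum>j\<in>J. M i j * c j) = 0) \<Longrightarrow> (\<And>j. j \<in> J \<Longrightarrow> c j = 0)"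
  shows "\<exists>c. \<forall>i\<in>I. (\<Sum>j\<in>J. M i j * c j) = b i"
  using assms
proof (induction J arbitrary: I M b rule: finite_induct)
  case empty
  then show ?case by simp
next
  case (insert a J)
  \<comment> \<open>A zero column would put the unit vector at \<open>a\<close> into the
    kernel.\<close>
  have "\<exists>i\<in>I. M i a \<noteq> 0"
  proof (rule ccontr)
    assume "\<not> (\<exists>i\<in>I. M i a \<noteq> 0)"
    then have "(\<Sum>j\<in>insert a J. M i j * (if j = a then 1 else 0)) = 0" if "i \<in> I" for i
      using that insert.hyps by (intro sum.neutral) auto
    from insert.prems(3)[OF this, of a] show False by simp
  qed
  then obtain r where r: "r \<in> I" "M r a \<noteq> 0" by blast
  define M' where "M' i j = M i j - M i a / M r a * M r j" for i j
  have ins: "(\<Sum>j\<in>insert a J. M i j * (c(a := z)) j) = M i a * z + (\<Sum>j\<in>J. M i j * c j)" for i c z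
  proof -
    have "(\<Sum>j\<in>J. M i j * (c(a := z)) j) = (\<Sum>j\<in>J. M i j * c j)"
      using insert.hyps by (intro sum.cong) auto
    then show ?thesis using insert.hyps by simp
  qed
  have M'_sum: "(\<Sum>j\<in>J. M' i j * c j) = (\<Sum>j\<in>J. M i j * c j) - M i a / M r a * (\<Sum>j\<in>J. M r j * c j)" for i c
    unfolding M'_def by (simp add: left_diff_distrib sum_subtractf sum_distrib_left mult.assoc)
  have "\<exists>c. \<forall>i\<in>I - {r}. (\<Sum>j\<in>J. M' i j * c j) = b i - M i a / M r a * b r"
  proof (rule insert.IH)
    show "card (I - {r}) = card J" using insert r by simp
    show "finite (I - {r})" using insert by simp
  next
    fix c j assume c: "\<And>i. i \<in> I - {r} \<Longrightarrow> (\<Sum>j\<in>J. M' i j * c j) = 0" and j: "j \<in> J"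
    \<comment> \<open>Back substitution: this value at \<open>a\<close> satisfies the pivot row, so
      a kernel vector of the reduced system extends to one of the full system.\<close>
    let ?z = "- (\<Sum>j\<in>J. M r j * c j) / M r a"
    have "(c(a := ?z)) j = 0"
    proof (rule insert.prems(3))
      fix i assume "i \<in> I"
      with c[of i] r show "(\<Sum>j\<in>insert a J. M i j * (c(a := ?z)) j) = 0"
        unfolding ins M'_sum by (cases "i = r") (auto simp: field_simps)
    qed (use j in simp)
    then show "c j = 0" using insert.hyps j by (metis fun_upd_other)
  qed
  then obtain c where c: "\<And>i. i \<in> I - {r} \<Longrightarrow> (\<Sum>j\<in>J. M' i j * c j) = b i - M i a / M r a * b r"
    by blast
  let ?z = "(b r - (\<Sum>j\<in>J. M r j * c j)) / M r a"
  have "(\<Sum>j\<in>insert a J. M i j * (c(a := ?z)) j) = b i" if "i \<in> I" for i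
    using that c[of i] r unfolding ins M'_sum by (cases "i = r") (auto simp: field_simps)
  then show ?case by blast
qed

lemma integral_eq_l2inner:
  "integral {-1/2..1/2} p = l2inner p (\<lambda>t. 1)"
  unfolding l2inner_def by simp

lemma l2inner_echar_sum_echar:
  assumes "i \<in> {- int n..int n}"
  shows "l2inner (\<lambda>t. \<Sum>k\<in>{- int n..int n}. c k * echar k t) (echar i) = c i"
proof -
  let ?d = "\<lambda>k. if k = i then 1 else (0::complex)"
  have eq: "echar i = (\<lambda>t. \<Sum>k\<in>{- int n..int n}. ?d k * echar k t)"
    using assms by (auto simp: if_distrib if_distribR cong: if_cong)
  have "l2inner (\<lambda>t. \<Sum>k\<in>{- int n..int n}. c k * echar k t) (echar i)
      = (\<Sum>k\<in>{- int n..int n}. c k * cnj (?d k))"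
    by (subst eq) (rule l2inner_echar_sums)
  also have "\<dots> = c i" using assms by (simp add: if_distrib if_distribR cong: if_cong)
  finally show ?thesis .
qed

lemma trig_poly_eqI:
  assumes "trig_poly n p" "trig_poly n q"
    and "\<And>i. i \<in> {- int n..int n} \<Longrightarrow> l2inner p (echar i) = l2inner q (echar i)"
  shows "p = q"
proof -
  from assms obtain c d where p: "p = (\<lambda>t. \<Sum>k\<in>{- int n..int n}. c k * echar k t)"
    and q: "q = (\<lambda>t. \<Sum>k\<in>{- int n..int n}. d k * echar k t)" unfolding trig_poly_echar by blast
  have "c i = d i" if "i \<in> {- int n..int n}" for i
    using assms(3)[OF that] that unfolding p q l2inner_echar_sum_echar[OF that] by simp
  then show ?thesis unfolding p q by (auto intro!: sum.cong)
qed

lemma l2norm_eq_0_imp: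
  assumes "trig_poly n p" "l2norm p = 0"
  shows "p = (\<lambda>t. 0)"
proof -
  from assms obtain c where p: "p = (\<lambda>t. \<Sum>k\<in>{- int n..int n}. c k * echar k t)"
    unfolding trig_poly_echar by blast
  have "(\<Sum>k\<in>{- int n..int n}. (cmod (c k))\<^sup>2) = 0"
    using assms(2) l2norm_echar_sum[of c n] unfolding p by simp
  then have "\<forall>k\<in>{- int n..int n}. c k = 0" by (subst (asm) sum_nonneg_eq_0_iff) auto
  then show ?thesis unfolding p by auto
qed

lemma l2inner_sum_left:
  assumes "\<And>i. i \<in> I \<Longrightarrow> trig_poly n (p i)" "trig_poly n h"
  shows "l2inner (\<lambda>t. \<Sum>i\<in>I. a i * p i t) h = (\<Sum>i\<in>I. a i * l2inner (p i) h)"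
  using assms(1)
proof (induction I rule: infinite_finite_induct)
  case (insert i I)
  have "l2inner (\<lambda>t. a i * p i t + (\<Sum>i\<in>I. a i * p i t)) h
      = l2inner (\<lambda>t. a i * p i t) h + l2inner (\<lambda>t. \<Sum>i\<in>I. a i * p i t) h"
    using insert.prems assms(2)
    by (intro l2inner_add_left continuous_on_trig_poly[of n] trig_poly_sum trig_poly_cmult) auto
  with insert show ?case by (simp add: l2inner_cmult_left)
qed (simp_all add: l2inner_def)

section \<open>The reproducing kernel and the operator built from it\<close>

text \<open>This is the Dirichlet kernel centred at \<open>y\<close>. Parseval shows that it
  reproduces, and any other reproducing kernel has the same inner products with the characters, so
  the description by \<open>THE\<close> is resolved.\<close>

lemma repkernel_eq:
  "repkernel n y = (\<lambda>t. \<Sum>k\<in>{- int n..int n}. echar (-k) y * echar k t)"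
  unfolding repkernel_def
proof (rule the_equality)
  let ?K = "\<lambda>t. \<Sum>k\<in>{- int n..int n}. echar (-k) y * echar k t"
  have K: "trig_poly n ?K" by (rule trig_poly_echar_sum)
  have rep: "p y = l2inner p ?K" if "trig_poly n p" for p
    using that by (elim trig_polyE) (simp add: l2inner_echar_sums cnj_echar)
  show "trig_poly n ?K \<and> (\<forall>p. trig_poly n p \<longrightarrow> p y = l2inner p ?K)"
    using K rep by blast
  fix k assume k: "trig_poly n k \<and> (\<forall>p. trig_poly n p \<longrightarrow> p y = l2inner p k)"
  show "k = ?K"
  proof (rule trig_poly_eqI)
    fix i assume "i \<in> {- int n..int n}"
    then have "trig_poly n (echar i)" by (intro trig_poly_echarI) auto
    then have "l2inner (echar i) k = l2inner (echar i) ?K" using k rep by metis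
    then show "l2inner k (echar i) = l2inner ?K (echar i)" by (metis cnj_l2inner)
  qed (use k K in auto)
qed

lemma trig_poly_repkernel: "trig_poly n (repkernel n y)"
  unfolding repkernel_eq by (rule trig_poly_echar_sum)

lemma l2inner_repkernel: "trig_poly n p \<Longrightarrow> l2inner p (repkernel n y) = p y"
  unfolding repkernel_eq
  by (elim trig_polyE) (simp add: l2inner_echar_sums cnj_echar)

lemma S_op_trig_poly:
  "trig_poly n p \<Longrightarrow> S_op L x \<tau> n p
     = (\<lambda>t. \<Sum>k=1..L n. complex_of_real (\<tau> n k) * p (x n k) * repkernel n (x n k) t)"
  by (simp add: S_op_def l2inner_repkernel)

lemma trig_poly_S_op: "trig_poly n (S_op L x \<tau> n p)"
  unfolding S_op_def by (intro trig_poly_sum trig_poly_cmult trig_poly_repkernel)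

text \<open>The form of the operator is the weighted inner product of samples. Its Hermitian
  symmetry is the self-adjointness used for the weights, and at \<open>g = p\<close> it is the sum
  in the Marcinkiewicz-Zygmund inequality.\<close>

lemma l2inner_S_op:
  assumes "trig_poly n p" "trig_poly n g"
  shows "l2inner (S_op L x \<tau> n p) g = (\<Sum>k=1..L n. complex_of_real (\<tau> n k) * p (x n k) * cnj (g (x n k)))"
proof -
  have "l2inner (repkernel n y) g = cnj (g y)" for y
    using l2inner_repkernel[OF assms(2)] cnj_l2inner by metis
  then show ?thesis
    unfolding S_op_trig_poly[OF assms(1)] using assms(2)
    by (subst l2inner_sum_left[where n = n]) (simp_all add: trig_poly_repkernel)
qed

lemma S_op_echar_sum:
  "S_op L x \<tau> n (\<lambda>t. \<Sum>k\<in>{- int n..int n}. c k * echar k t)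
     = (\<lambda>t. \<Sum>k\<in>{- int n..int n}. c k * S_op L x \<tau> n (echar k) t)"
proof -
  have "S_op L x \<tau> n (\<lambda>t. \<Sum>k\<in>{- int n..int n}. c k * echar k t)
      = (\<lambda>t. \<Sum>k\<in>{- int n..int n}. c k * (\<Sum>j=1..L n. complex_of_real (\<tau> n j) * echar k (x n j) * repkernel n (x n j) t))"
    unfolding S_op_trig_poly[OF trig_poly_echar_sum] sum_distrib_left sum_distrib_right
    by (subst sum.swap) (simp add: mult_ac)
  moreover have "S_op L x \<tau> n (echar k) t
       = (\<Sum>j=1..L n. complex_of_real (\<tau> n j) * echar k (x n j) * repkernel n (x n j) t)"
    if "k \<in> {- int n..int n}" for k t
    using that S_op_trig_poly[OF trig_poly_echarI[of k n], of L x \<tau>] by force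
  ultimately show ?thesis by (auto intro!: sum.cong)
qed

text \<open>For the difference d of two solutions, the form at (d, d) vanishes. It equals the
  sampled sum of |d|^2, which dominates A times the squared norm of d, so d = 0.\<close>

lemma S_op_inj:
  assumes MZ: "MZ_family L x \<tau> A B" "n \<ge> 1"
    and "trig_poly n p" "trig_poly n q" "S_op L x \<tau> n p = S_op L x \<tau> n q"
  shows "p = q"
proof -
  define d where "d = (\<lambda>t. p t - q t)"
  have d: "trig_poly n d" unfolding d_def using assms(3-4) by (rule trig_poly_diff)
  have "l2inner (S_op L x \<tau> n d) d = l2inner (S_op L x \<tau> n p) d - l2inner (S_op L x \<tau> n q) d"
    unfolding l2inner_S_op[OF d d] l2inner_S_op[OF assms(3) d] l2inner_S_op[OF assms(4) d]
      sum_subtractf[symmetric]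
    by (intro sum.cong) (simp_all add: d_def algebra_simps)
  then have "(\<Sum>k=1..L n. complex_of_real (\<tau> n k) * d (x n k) * cnj (d (x n k))) = 0"
    using assms(5) l2inner_S_op[OF d d] by simp
  moreover have "complex_of_real (\<Sum>k=1..L n. (cmod (d (x n k)))\<^sup>2 * \<tau> n k)
      = (\<Sum>k=1..L n. complex_of_real (\<tau> n k) * d (x n k) * cnj (d (x n k)))"
    by (simp add: complex_norm_square mult_ac del: of_real_power)
  ultimately have "(\<Sum>k=1..L n. (cmod (d (x n k)))\<^sup>2 * \<tau> n k) = 0" by (metis of_real_eq_0_iff)
  with MZ d have "0 < A" "A * (l2norm d)\<^sup>2 \<le> 0" unfolding MZ_family_def by metis+
  then have "l2norm d = 0" by (simp add: mult_le_0_iff)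
  from l2norm_eq_0_imp[OF d this] have "d t = 0" for t by simp
  then show ?thesis unfolding d_def by auto
qed

text \<open>The operator maps a space of dimension 2n + 1 to itself. In the basis of characters it
  becomes a square system, whose kernel is trivial by injectivity.\<close>

lemma S_op_surj:
  assumes MZ: "MZ_family L x \<tau> A B" "n \<ge> 1"
    and g: "trig_poly n g"
  shows "\<exists>p. trig_poly n p \<and> S_op L x \<tau> n p = g"
proof -
  let ?I = "{- int n..int n}"
  define P where "P c = (\<lambda>t. \<Sum>k\<in>?I. c k * echar k t)" for c
  have P: "trig_poly n (P c)" for c unfolding P_def by (rule trig_poly_echar_sum)
  define M where "M i j = l2inner (S_op L x \<tau> n (echar j)) (echar i)" for i j
  have M: "(\<Sum>j\<in>?I. M i j * c j) = l2inner (S_op L x \<tau> n (P c)) (echar i)" if "i \<in> ?I" for i c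
    unfolding M_def P_def S_op_echar_sum using that
    by (subst l2inner_sum_left[where n = n]) (auto simp: trig_poly_S_op mult.commute intro!: trig_poly_echarI)
  have "\<exists>c. \<forall>i\<in>?I. (\<Sum>j\<in>?I. M i j * c j) = l2inner g (echar i)"
  proof (rule solve_injective_linear_system)
    fix c j assume c: "\<And>i. i \<in> ?I \<Longrightarrow> (\<Sum>j\<in>?I. M i j * c j) = 0" and j: "j \<in> ?I"
    have "S_op L x \<tau> n (P c) = (\<lambda>t. 0)"
      using c M by (intro trig_poly_eqI[of n]) (auto simp: trig_poly_S_op l2inner_def)
    also have "\<dots> = S_op L x \<tau> n (\<lambda>t. 0)" by (simp add: S_op_def l2inner_def)
    finally have "P c = (\<lambda>t. 0)"
      using S_op_inj[OF MZ P trig_poly_zero] by blast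
    then have "l2inner (P c) (echar j) = 0" by (simp add: l2inner_def)
    then show "c j = 0" unfolding P_def l2inner_echar_sum_echar[OF j] .
  qed auto
  then obtain c where "\<And>i. i \<in> ?I \<Longrightarrow> (\<Sum>j\<in>?I. M i j * c j) = l2inner g (echar i)"
    by blast
  then have "l2inner (S_op L x \<tau> n (P c)) (echar i) = l2inner g (echar i)" if "i \<in> ?I" for i
    using M[OF that] that by metis
  then have "S_op L x \<tau> n (P c) = g" by (intro trig_poly_eqI[of n] trig_poly_S_op g) auto
  with P show ?thesis by blast
qed

section \<open>Weights, exactness and stability\<close>

lemma MZ_weights:
  assumes "MZ_family L x \<tau> A B" "n \<ge> 1"
  obtains q where "trig_poly n q" "S_op L x \<tau> n q = (\<lambda>t. 1)"
    "\<And>k. k \<in> {1..L n} \<Longrightarrow> qweight L x \<tau> n k = complex_of_real (\<tau> n k) * cnj (q (x n k))"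
proof -
  have \<tau>: "\<And>k. k \<in> {1..L n} \<Longrightarrow> 0 < \<tau> n k"
    using assms unfolding MZ_family_def by blast
  obtain q where q: "trig_poly n q" "S_op L x \<tau> n q = (\<lambda>t. 1)"
    using S_op_surj[OF assms trig_poly_const[of n 1]] by blast
  have "qweight L x \<tau> n k = complex_of_real (\<tau> n k) * cnj (q (x n k))" if k: "k \<in> {1..L n}" for k
  proof -
    let ?g = "\<lambda>t. complex_of_real (sqrt (\<tau> n k)) * repkernel n (x n k) t"
    define e where "e = e_fun L x \<tau> n k"
    \<comment> \<open>Bijectivity of the operator is what makes the \<open>THE\<close> in
      \<open>e_fun\<close> denote.\<close>
    have "\<exists>!e. trig_poly n e \<and> S_op L x \<tau> n e = ?g"
    proof (rule ex_ex1I)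
      show "\<exists>e. trig_poly n e \<and> S_op L x \<tau> n e = ?g"
        using S_op_surj[OF assms trig_poly_cmult[OF trig_poly_repkernel]] .
      show "\<And>e e'. trig_poly n e \<and> S_op L x \<tau> n e = ?g \<Longrightarrow> trig_poly n e' \<and> S_op L x \<tau> n e' = ?g \<Longrightarrow> e = e'"
        using S_op_inj[OF assms] by metis
    qed
    then have e: "trig_poly n e" "S_op L x \<tau> n e = ?g"
      unfolding e_def e_fun_def by (rule theI'[THEN conjunct1], rule theI'[THEN conjunct2])
    \<comment> \<open>The integral is an inner product with 1. Writing 1 as the image of
      \<open>q\<close> lets the operator be moved onto \<open>e\<close>, whose image is a known
      multiple of the kernel; the kernel then evaluates \<open>q\<close>.\<close>
    have "integral {-1/2..1/2} e = l2inner e (S_op L x \<tau> n q)"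
      by (simp only: q integral_eq_l2inner)
    also have "\<dots> = cnj (l2inner (S_op L x \<tau> n q) e)" by (simp add: cnj_l2inner)
    also have "\<dots> = l2inner (S_op L x \<tau> n e) q"
      unfolding l2inner_S_op[OF e(1) q(1)] l2inner_S_op[OF q(1) e(1)] by (simp add: mult_ac)
    also have "\<dots> = complex_of_real (sqrt (\<tau> n k)) * cnj (l2inner q (repkernel n (x n k)))"
      by (simp add: e l2inner_cmult_left cnj_l2inner)
    also have "\<dots> = complex_of_real (sqrt (\<tau> n k)) * cnj (q (x n k))"
      by (simp add: l2inner_repkernel q)
    finally have "qweight L x \<tau> n k = complex_of_real (sqrt (\<tau> n k) * sqrt (\<tau> n k)) * cnj (q (x n k))"
      unfolding qweight_def e_def[symmetric] by (simp only: of_real_mult mult.assoc)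
    then show ?thesis using \<tau>[OF k] by simp
  qed
  with q show thesis using that by blast
qed

lemma quad_exact:
  assumes "MZ_family L x \<tau> A B" "n \<ge> 1" "trig_poly n p"
  shows "quad L x \<tau> n p = integral {-1/2..1/2} p"
proof -
  obtain q where q: "trig_poly n q" "S_op L x \<tau> n q = (\<lambda>t. 1)"
    "\<And>k. k \<in> {1..L n} \<Longrightarrow> qweight L x \<tau> n k = complex_of_real (\<tau> n k) * cnj (q (x n k))"
    using MZ_weights[OF assms(1,2)] by blast
  have "quad L x \<tau> n p = (\<Sum>k=1..L n. complex_of_real (\<tau> n k) * p (x n k) * cnj (q (x n k)))"
    unfolding quad_def by (intro sum.cong) (auto simp: q)
  also have "\<dots> = cnj (l2inner (S_op L x \<tau> n q) p)"
    using q assms(3) by (subst l2inner_S_op) (auto simp: mult_ac)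
  also have "\<dots> = integral {-1/2..1/2} p" by (simp only: q integral_eq_l2inner cnj_l2inner)
  finally show ?thesis .
qed

text \<open>The Cauchy-Schwarz inequality splits \<tau>|q| as sqrt \<tau> times sqrt \<tau> |q|. The
  total weight is at most B, by the upper bound for the polynomial 1. The other factor Q, the
  sampled sum of |q|^2, is the form at (q, q); since q is mapped to 1, it equals the modulus of the
  mean of q. Hence Q is at most the norm of q, and the lower bound gives A Q^2 \<le> Q, that is Q
  \<le> 1/A.\<close>

lemma sum_qweight_le:
  assumes "MZ_family L x \<tau> A B" "n \<ge> 1"
  shows "(\<Sum>k=1..L n. cmod (qweight L x \<tau> n k)) \<le> sqrt (B / A)"
proof -
  have A: "0 < A" "0 < B"
    and MZ: "\<And>p. trig_poly n p \<Longrightarrow> A * (l2norm p)\<^sup>2 \<le> (\<Sum>k=1..L n. (cmod (p (x n k)))\<^sup>2 * \<tau> n k)"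
    and MZ': "\<And>p. trig_poly n p \<Longrightarrow> (\<Sum>k=1..L n. (cmod (p (x n k)))\<^sup>2 * \<tau> n k) \<le> B * (l2norm p)\<^sup>2"
    and \<tau>: "\<And>k. k \<in> {1..L n} \<Longrightarrow> 0 < \<tau> n k"
    using assms unfolding MZ_family_def by blast+
  obtain q where q: "trig_poly n q" "S_op L x \<tau> n q = (\<lambda>t. 1)"
    "\<And>k. k \<in> {1..L n} \<Longrightarrow> qweight L x \<tau> n k = complex_of_real (\<tau> n k) * cnj (q (x n k))"
    using MZ_weights[OF assms] by blast
  define Q where "Q = (\<Sum>k=1..L n. (cmod (q (x n k)))\<^sup>2 * \<tau> n k)"
  have Q0: "0 \<le> Q" unfolding Q_def using \<tau> by (intro sum_nonneg mult_nonneg_nonneg) (auto intro: less_imp_le)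
  obtain c where c: "q = (\<lambda>t. \<Sum>k\<in>{- int n..int n}. c k * echar k t)"
    using q(1) by (elim trig_polyE)
  have "complex_of_real Q = l2inner (S_op L x \<tau> n q) q"
    unfolding Q_def l2inner_S_op[OF q(1,1)] by (simp add: complex_norm_square mult_ac del: of_real_power)
  also have "\<dots> = cnj (l2inner q (echar 0))" 
    unfolding q(2) cnj_l2inner by (simp add: l2inner_def)
  also have "l2inner q (echar 0) = c 0" unfolding c by (rule l2inner_echar_sum_echar) auto
  finally have "Q = cmod (c 0)" using Q0
    by (metis abs_of_nonneg complex_mod_cnj norm_of_real)
  then have "Q\<^sup>2 = (\<Sum>k\<in>{0}. (cmod (c k))\<^sup>2)" by simp
  also have "\<dots> \<le> (\<Sum>k\<in>{- int n..int n}. (cmod (c k))\<^sup>2)" by (intro sum_mono2) auto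
  also have "\<dots> = (l2norm q)\<^sup>2" unfolding c l2norm_echar_sum ..
  finally have "A * Q\<^sup>2 \<le> Q" using MZ[OF q(1)] A unfolding Q_def[symmetric]
    by (meson mult_left_mono less_imp_le order_trans)
  then have AQ: "Q \<le> 1 / A" using Q0 A
    by (cases "Q = 0") (auto simp: power2_eq_square field_simps)
  have "(\<Sum>k=1..L n. \<tau> n k) \<le> B * (l2norm (\<lambda>t. 1))\<^sup>2" using MZ'[OF trig_poly_const[of n 1]] by simp
  also have "(l2norm (\<lambda>t. 1))\<^sup>2 = 1" by (simp add: l2norm_def)
  finally have \<tau>B: "(\<Sum>k=1..L n. \<tau> n k) \<le> B" by simp
  have "(\<Sum>k=1..L n. cmod (qweight L x \<tau> n k)) = (\<Sum>k=1..L n. sqrt (\<tau> n k) * (sqrt (\<tau> n k) * cmod (q (x n k))))"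
    using \<tau> by (intro sum.cong refl) (simp add: q norm_mult less_imp_le mult.assoc[symmetric])
  then have "(\<Sum>k=1..L n. cmod (qweight L x \<tau> n k))\<^sup>2
      \<le> (\<Sum>k=1..L n. (sqrt (\<tau> n k))\<^sup>2) * (\<Sum>k=1..L n. (sqrt (\<tau> n k) * cmod (q (x n k)))\<^sup>2)"
    using Cauchy_Schwarz_ineq_sum by metis
  also have "(\<Sum>k=1..L n. (sqrt (\<tau> n k))\<^sup>2) = (\<Sum>k=1..L n. \<tau> n k)"
    using \<tau> by (intro sum.cong) (auto intro: less_imp_le)
  also have "(\<Sum>k=1..L n. (sqrt (\<tau> n k) * cmod (q (x n k)))\<^sup>2) = Q"
    unfolding Q_def using \<tau> by (intro sum.cong) (auto simp: power_mult_distrib less_imp_le)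
  also have "(\<Sum>k=1..L n. \<tau> n k) * Q \<le> B * (1 / A)"
    using \<tau>B AQ Q0 A by (intro mult_mono) auto
  finally show ?thesis by (intro real_le_rsqrt) simp
qed

text \<open>Exactness replaces f by f - p in both terms. The interval has length 1, so the integral
  contributes \<delta>, and the bound on the weights contributes sqrt (B / A) times \<delta>. An
  arbitrary uniform bound \<delta> suits explicit approximants better than a supremum would.\<close>

lemma quad_error_le:
  assumes MZ: "MZ_family L x \<tau> A B" "n \<ge> 1" and f: "continuous_on UNIV f"
    and p: "trig_poly n p" and \<delta>: "\<And>t. cmod (f t - p t) \<le> \<delta>"
  shows "cmod (integral {-1/2..1/2} f - quad L x \<tau> n f) \<le> (1 + sqrt (B / A)) * \<delta>"
proof -
  have \<delta>0: "0 \<le> \<delta>" using \<delta>[of 0] norm_ge_zero order_trans by blast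
  have cont: "continuous_on {-1/2..1/2} f" "continuous_on {-1/2..1/2} p"
    using f continuous_on_subset continuous_on_trig_poly[OF p] by blast+
  let ?I = "integral {-1/2..1/2} (\<lambda>t. f t - p t)"
  let ?Q = "\<Sum>k=1..L n. (f (x n k) - p (x n k)) * qweight L x \<tau> n k"
  have "?I = integral {-1/2..1/2} f - integral {-1/2..1/2} p"
    using cont by (intro Henstock_Kurzweil_Integration.integral_diff integrable_continuous_interval)
  moreover have "?Q = quad L x \<tau> n f - quad L x \<tau> n p"
    unfolding quad_def by (simp add: sum_subtractf left_diff_distrib)
  ultimately have eq: "integral {-1/2..1/2} f - quad L x \<tau> n f = ?I - ?Q"
    unfolding quad_exact[OF MZ p] by (simp only:) (simp only: diff_diff_eq2 diff_add_cancel)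
  have I: "cmod ?I \<le> \<delta> * (1/2 - (-1/2))"
    by (rule integral_bound[OF _ continuous_on_diff[OF cont]]) (use \<delta> in simp_all)
  have "cmod ?Q \<le> (\<Sum>k=1..L n. \<delta> * cmod (qweight L x \<tau> n k))"
    using \<delta> by (intro sum_norm_le) (simp add: norm_mult mult_right_mono)
  also have "\<dots> \<le> \<delta> * sqrt (B / A)"
    unfolding sum_distrib_left[symmetric] using sum_qweight_le[OF MZ] \<delta>0 by (rule mult_left_mono)
  finally have "cmod ?Q \<le> \<delta> * sqrt (B / A)" .
  with I have "cmod ?I + cmod ?Q \<le> \<delta> + \<delta> * sqrt (B / A)" by (intro add_mono) simp_all
  also have "\<delta> + \<delta> * sqrt (B / A) = (1 + sqrt (B / A)) * \<delta>" by (simp add: algebra_simps)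
  finally show ?thesis unfolding eq using norm_triangle_ineq4[of ?I ?Q] by (rule order_trans[rotated])
qed

section \<open>A Jackson kernel\<close>

lemma has_integral_norm2_echar_nat_sum:
  assumes "finite J"
  shows "((\<lambda>t. (cmod (\<Sum>j\<in>J. c j * echar (int j) t))\<^sup>2) has_integral (\<Sum>j\<in>J. (cmod (c j))\<^sup>2)) {a..a+1}"
  using has_integral_norm2_echar_sum[of "int ` J" "\<lambda>k. c (nat k)" a] assms
  by (simp add: sum.reindex)

text \<open>The interval is written \<open>{y-1..y-1+1}\<close> so that integrals over
  \<open>{a..a+1}\<close> apply directly with a = y - 1.\<close>

lemma has_integral_reflect_shift:
  fixes g :: "real \<Rightarrow> 'a::real_normed_vector"
  assumes "(g has_integral i) {y-1..y-1+1}"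
  shows "((\<lambda>t. g (y - t)) has_integral i) {0..1}"
proof -
  have "(g has_integral i) {-1 + y..0 + y}" using assms by (simp add: algebra_simps)
  then have "((g \<circ> (+) y) has_integral i) {-1..0}" by (simp only: has_integral_shift_Icc_real)
  then have "((\<lambda>t. (g \<circ> (+) y) (- t)) has_integral i) {- 0..- (-1)}"
    by (simp only: has_integral_reflect_real)
  then show ?thesis by (simp add: o_def)
qed

lemma has_integral_echar_coeff:
  assumes "finite I" "i \<in> I"
  shows "((\<lambda>t. (\<Sum>k\<in>I. c k * echar k t) * echar (-i) t) has_integral c i) {a..a+1}"
proof -
  have "((\<lambda>t. \<Sum>k\<in>I. c k * echar (k - i) t) has_integral
      (\<Sum>k\<in>I. c k * (if k - i = 0 then 1 else 0))) {a..a+1}"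
    using assms by (intro has_integral_sum has_integral_mult_right has_integral_echar) auto
  moreover have "(\<Sum>k\<in>I. c k * echar k t) * echar (-i) t = (\<Sum>k\<in>I. c k * echar (k - i) t)" for t
    using echar_mult[of _ t "-i"] by (simp add: sum_distrib_right mult.assoc)
  moreover have "(\<Sum>k\<in>I. c k * (if k - i = 0 then 1 else 0)) = c i"
    using assms by (simp add: if_distrib if_distribR cong: if_cong)
  ultimately show ?thesis by simp
qed

text \<open>With m the integer nearest to u and v = u - m, the chord is 2 |sin (pi v)|, which
  dominates |v| because |pi v| stays below the first positive zero of the sine. This converts the
  weight in the kernel's second moment into a bound by distance.\<close>

lemma torus_distance:
  fixes u :: real
  obtains m :: int where "\<bar>u - of_int m\<bar> \<le> cmod (1 - echar 1 u)"
proof -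
  define m where "m = round u"
  define v where "v = u - of_int m"
  have v: "\<bar>v\<bar> \<le> 1/2" unfolding v_def m_def using of_int_round_abs_le[of u] by (simp add: abs_minus_commute)
  let ?x = "pi * v"
  have x: "\<bar>?x\<bar> \<le> 2"
    using v pi_less_4 mult_mono[of pi 4 "\<bar>v\<bar>" "1/2"] by (simp add: abs_mult)
  \<comment> \<open>For |x| \<le> 2 the cubic remainder is at most 2/3 of |x|, which leaves |sin x|
    \<ge> |x| / 3. With |x| \<ge> 2 |v| this yields |v| \<le> (3/2) |sin x|, within the factor 2
    needed.\<close>
  have "\<bar>sin ?x - ?x\<bar> \<le> \<bar>?x\<bar> ^ 3 / 6"
    using Maclaurin_sin_bound[of ?x 3] by (simp add: sin_coeff_def numeral_3_eq_3 fact_numeral)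
  also have "\<dots> \<le> \<bar>?x\<bar> * 2\<^sup>2 / 6"
    using mult_left_mono[OF power_mono[OF x abs_ge_zero, of 2] abs_ge_zero[of ?x]]
    by (simp only: power2_eq_square power3_eq_cube mult.assoc divide_right_mono)
  finally have "\<bar>sin ?x - ?x\<bar> \<le> 2 / 3 * \<bar>?x\<bar>" by simp
  then have "\<bar>sin ?x\<bar> \<ge> \<bar>?x\<bar> / 3" by arith
  moreover have "\<bar>?x\<bar> \<ge> 2 * \<bar>v\<bar>" using pi_ge_two by (simp add: abs_mult mult_right_mono)
  ultimately have "\<bar>v\<bar> \<le> 2 * \<bar>sin ?x\<bar>" by arith
  also have "2 * \<bar>sin ?x\<bar> = cmod (1 - cis (2 * ?x))"
  proof -
    have "(cmod (1 - cis (2 * ?x)))\<^sup>2 = (1 - cos (2 * ?x))\<^sup>2 + (sin (2 * ?x))\<^sup>2"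
      by (simp add: cmod_power2)
    also have "\<dots> = 2 - 2 * cos (2 * ?x)"
      using sin_cos_squared_add[of "2 * ?x"] by (simp add: power2_diff algebra_simps)
    also have "\<dots> = (2 * \<bar>sin ?x\<bar>)\<^sup>2" by (simp add: cos_double_sin power_mult_distrib)
    finally show ?thesis using power2_eq_iff_nonneg[of "cmod (1 - cis (2 * ?x))" "2 * \<bar>sin ?x\<bar>"] by simp
  qed
  also have "cis (2 * ?x) = echar 1 v" by (simp add: echar_def mult.assoc)
  also have "\<dots> = echar 1 u" unfolding v_def by (rule echar_diff_int)
  finally show thesis using that unfolding v_def by blast
qed

text \<open>The three terms come from the power sums of j^2, j^3 and j^4. Keeping \<open>X\<close>
  apart from the number of terms leaves the summand fixed during the induction; both become N
  afterwards.\<close>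

lemma sum_parabola_sq:
  fixes X :: real
  shows "30 * (\<Sum>j<m. (real j * (X - real j))\<^sup>2)
     = 5 * X\<^sup>2 * ((real m - 1) * real m * (2 * real m - 1)) - 15 * X * (real m * (real m - 1))\<^sup>2
       + (real m - 1) * real m * (2 * real m - 1) * (3 * (real m)\<^sup>2 - 3 * real m - 1)"
  by (induction m) (simp_all add: algebra_simps power2_eq_square)

text \<open>The sum is exactly (N^5 - N) / 30. For N \<ge> 2 the subtracted N is at most N^5 / 16,
  and 15/16 divided by 30 is 1/32.\<close>

lemma sum_parabola_sq_ge:
  assumes "N \<ge> 2"
  shows "(real N) ^ 5 / 32 \<le> (\<Sum>j<N. (real j * (real N - real j))\<^sup>2)"
proof -
  have "30 * (\<Sum>j<N. (real j * (real N - real j))\<^sup>2) = real N ^ 5 - real N"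
    unfolding sum_parabola_sq by (simp add: algebra_simps power2_eq_square numeral_eq_Suc)
  moreover have "real N * 16 \<le> real N ^ 5"
    using mult_left_mono[OF power_mono[of 2 "real N" 4], of "real N"] assms by (simp add: numeral_eq_Suc)
  ultimately show ?thesis by simp
qed

text \<open>
  The kernel is \<open>|q|\<^sup>2\<close> divided by its mean, where \<open>q\<close> has the parabolic coefficients \<open>j (N - j)\<close>.
  Summation by parts turns \<open>(1 - e(t)) q(t)\<close> into a trigonometric sum with coefficients of size
  \<open>O(N)\<close> instead of \<open>O(N\<^sup>2)\<close>, so Parseval bounds the second moment by \<open>O(N\<^sup>-\<^sup>2)\<close>.
\<close>

lemma jackson_kernel:
  fixes n :: nat
  obtains K :: "real \<Rightarrow> real" and \<kappa> :: "int \<Rightarrow> complex" and v :: real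
  where "\<And>t. 0 \<le> K t"
    "\<And>t. complex_of_real (K t) = (\<Sum>k\<in>{- int n..int n}. \<kappa> k * echar k t)"
    "\<And>k. k \<in> {- int n..int n} \<Longrightarrow> cmod (\<kappa> k) \<le> 1"
    "\<And>y. ((\<lambda>t. K (y - t)) has_integral 1) {0..1}"
    "\<And>y. ((\<lambda>t. K (y - t) * (cmod (1 - echar 1 (y - t)))\<^sup>2) has_integral v) {0..1}"
    "v \<le> 32 / (real n + 2)\<^sup>2"
proof -
  \<comment> \<open>The coefficients vanish at 0 and N, so only the frequencies 1 to n + 1 occur in
    q, and |q|^2 has degree n.\<close>
  define N where "N = n + 2"
  define a where "a j = real j * (real N - real j)" for j :: nat
  define q where "q t = (\<Sum>j<N. complex_of_real (a j) * echar (int j) t)" for t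
  define s where "s = (\<Sum>j<N. (a j)\<^sup>2)"
  have s: "(real N) ^ 5 / 32 \<le> s" unfolding s_def a_def by (rule sum_parabola_sq_ge) (simp add: N_def)
  have s0: "s > 0" by (rule less_le_trans[OF _ s]) (simp add: N_def)
  define K where "K t = (cmod (q t))\<^sup>2 / s" for t
  define v where "v = (\<Sum>j<N. (a (Suc j) - a j)\<^sup>2) / s"

  have "trig_poly n (\<lambda>t. (\<Sum>i\<in>{1..<N}. \<Sum>j\<in>{1..<N}. complex_of_real (a i * a j / s) * echar (int i - int j) t))"
    by (intro trig_poly_sum trig_poly_cmult trig_poly_echarI) (auto simp: N_def)
  moreover have "complex_of_real (K t)
      = (\<Sum>i\<in>{1..<N}. \<Sum>j\<in>{1..<N}. complex_of_real (a i * a j / s) * echar (int i - int j) t)" for t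
  proof -
    have q1: "q t = (\<Sum>j\<in>{1..<N}. complex_of_real (a j) * echar (int j) t)"
      unfolding q_def by (rule sum.mono_neutral_right) (auto simp: a_def)
    have "complex_of_real (K t) = q t * cnj (q t) / complex_of_real s"
      unfolding K_def complex_norm_square[symmetric] by simp
    also have "\<dots> = (\<Sum>i\<in>{1..<N}. \<Sum>j\<in>{1..<N}. complex_of_real (a i * a j / s) * (echar (int i) t * echar (- int j) t))"
      unfolding q1 by (simp add: sum_product sum_divide_distrib cnj_echar mult_ac)
    finally show ?thesis by (simp add: echar_mult)
  qed
  ultimately have "trig_poly n (\<lambda>t. complex_of_real (K t))" by simp
  then obtain \<kappa> where "(\<lambda>t. complex_of_real (K t)) = (\<lambda>t. \<Sum>k\<in>{- int n..int n}. \<kappa> k * echar k t)"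
    by (rule trig_polyE)
  then have \<kappa>: "complex_of_real (K t) = (\<Sum>k\<in>{- int n..int n}. \<kappa> k * echar k t)" for t by meson

  have K0: "0 \<le> K t" for t using s0 unfolding K_def by simp
  have K1: "(K has_integral 1) {b..b+1}" for b
  proof -
    have "((\<lambda>t. (cmod (q t))\<^sup>2) has_integral s) {b..b+1}"
      using has_integral_norm2_echar_nat_sum[of "{..<N}" "\<lambda>j. complex_of_real (a j)" b]
      unfolding q_def s_def by simp
    from has_integral_divide[OF this, of s] s0 show ?thesis unfolding K_def by simp
  qed
  have Kv: "((\<lambda>t. K t * (cmod (1 - echar 1 t))\<^sup>2) has_integral v) {b..b+1}" for b
  proof -
    have parts: "q t * (echar 1 t - 1) = - (\<Sum>j<N. complex_of_real (a (Suc j) - a j) * echar (int j) t) * echar 1 t" for t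
    proof -
      \<comment> \<open>The term at j = N is zero, so it can be added for the index shift; the one
        at j = 0 is then dropped for the same reason.\<close>
      have "q t = (\<Sum>j<Suc N. complex_of_real (a j) * echar (int j) t)"
        unfolding q_def by (simp add: a_def)
      also have "\<dots> = (\<Sum>j<N. complex_of_real (a (Suc j)) * echar (int (Suc j)) t)"
        by (subst sum.lessThan_Suc_shift) (simp add: a_def)
      also have "\<dots> = (\<Sum>j<N. complex_of_real (a (Suc j)) * echar (int j) t) * echar 1 t"
        using echar_mult[of _ t 1] by (simp add: sum_distrib_right mult.assoc add.commute)
      finally have "q t = (\<Sum>j<N. complex_of_real (a (Suc j)) * echar (int j) t) * echar 1 t" .
      then have "q t * (echar 1 t - 1) = q t * echar 1 t - (\<Sum>j<N. complex_of_real (a (Suc j)) * echar (int j) t) * echar 1 t"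
        by (simp add: algebra_simps)
      also have "\<dots> = - (\<Sum>j<N. complex_of_real (a (Suc j) - a j) * echar (int j) t) * echar 1 t"
        unfolding q_def by (simp add: algebra_simps sum_subtractf)
      finally show ?thesis .
    qed
    have "(cmod (q t))\<^sup>2 * (cmod (1 - echar 1 t))\<^sup>2
        = (cmod (\<Sum>j<N. complex_of_real (a (Suc j) - a j) * echar (int j) t))\<^sup>2" for t
      using arg_cong[OF parts, of cmod t]
      by (simp only: norm_mult norm_minus_cancel norm_echar mult_1_right power_mult_distrib[symmetric]
           norm_minus_commute[of 1])
    moreover have "((\<lambda>t. (cmod (\<Sum>j<N. complex_of_real (a (Suc j) - a j) * echar (int j) t))\<^sup>2) has_integral
        (\<Sum>j<N. (a (Suc j) - a j)\<^sup>2)) {b..b+1}"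
      using has_integral_norm2_echar_nat_sum[of "{..<N}" "\<lambda>j. complex_of_real (a (Suc j) - a j)" b]
      by (simp only: norm_of_real power2_abs finite_lessThan)
    ultimately have "((\<lambda>t. (cmod (q t))\<^sup>2 * (cmod (1 - echar 1 t))\<^sup>2) has_integral
        (\<Sum>j<N. (a (Suc j) - a j)\<^sup>2)) {b..b+1}" by simp
    from has_integral_divide[OF this, of s] show ?thesis unfolding K_def v_def by simp
  qed
  have "v \<le> 32 / (real n + 2)\<^sup>2"
  proof -
    have "(\<Sum>j<N. (a (Suc j) - a j)\<^sup>2) \<le> (\<Sum>j<N. (real N)\<^sup>2)"
    proof (rule sum_mono)
      fix j assume "j \<in> {..<N}"
      then have "\<bar>a (Suc j) - a j\<bar> \<le> real N" unfolding a_def by (simp add: algebra_simps)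
      then show "(a (Suc j) - a j)\<^sup>2 \<le> (real N)\<^sup>2" by (simp add: abs_le_square_iff[symmetric])
    qed
    then have "(\<Sum>j<N. (a (Suc j) - a j)\<^sup>2) \<le> real N ^ 3" by (simp add: power2_eq_square power3_eq_cube)
    then have "v \<le> real N ^ 3 / (real N ^ 5 / 32)"
      unfolding v_def using s by (intro frac_le) (auto simp: N_def)
    also have "\<dots> = 32 / (real n + 2)\<^sup>2" 
    proof -
      have "real N \<noteq> 0" "real n + 2 = real N" by (simp_all add: N_def)
      then show ?thesis by (simp add: field_simps flip: power_add)
    qed
    finally show ?thesis .
  qed
  \<comment> \<open>A Fourier coefficient of a nonnegative function is at most its mean, here
    1.\<close>
  moreover have "cmod (\<kappa> k) \<le> 1" if k: "k \<in> {- int n..int n}" for k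
  proof -
    have "((\<lambda>t. complex_of_real (K t) * echar (-k) t) has_integral \<kappa> k) {0..0+1}"
      unfolding \<kappa> by (rule has_integral_echar_coeff) (use k in auto)
    then have int: "(\<lambda>t. complex_of_real (K t) * echar (-k) t) integrable_on {0..1}"
      "integral {0..1} (\<lambda>t. complex_of_real (K t) * echar (-k) t) = \<kappa> k"
      by (auto simp: has_integral_integral integral_unique)
    have "cmod (integral {0..1} (\<lambda>t. complex_of_real (K t) * echar (-k) t)) \<le> integral {0..1} K"
      using int(1) K1[of 0] K0 by (intro integral_norm_bound_integral) (auto simp: norm_mult)
    also have "\<dots> = 1" using K1[of 0] by (auto simp: integral_unique)
    finally show ?thesis using int by simp
  qed
  ultimately show thesis
    using that[OF K0 \<kappa> _ has_integral_reflect_shift[OF K1] has_integral_reflect_shift[OF Kv]] by blast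
qed

text \<open>The sum is the convolution of f with the kernel, so the error is the average of f(y) -
  f(t) against K(y - t). The majorant in the hypothesis is made of the two functions whose averages
  are known. The multipliers appear in the conclusion because truncation of the sum later relies on
  their bound.\<close>

lemma jackson_approx:
  fixes f :: "real \<Rightarrow> complex" and n :: nat
  assumes f: "continuous_on UNIV f" and "b \<ge> 0"
    and bound: "\<And>y t. cmod (f y - f t) \<le> a + b * (cmod (1 - echar 1 (y - t)))\<^sup>2"
  shows "\<exists>\<kappa>. (\<forall>k\<in>{- int n..int n}. cmod (\<kappa> k) \<le> 1) \<and>
    (\<forall>y. cmod (f y - (\<Sum>k\<in>{- int n..int n}. \<kappa> k * fourier_coeff f k * echar k y)) \<le> a + 32 * b / (real n + 2)\<^sup>2)"
proof -
  let ?I = "{- int n..int n}"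
  obtain K \<kappa> v where K: "\<And>t. 0 \<le> K t"
    "\<And>t. complex_of_real (K t) = (\<Sum>k\<in>?I. \<kappa> k * echar k t)"
    "\<And>k. k \<in> ?I \<Longrightarrow> cmod (\<kappa> k) \<le> 1"
    "\<And>y. ((\<lambda>t. K (y - t)) has_integral 1) {0..1}"
    "\<And>y. ((\<lambda>t. K (y - t) * (cmod (1 - echar 1 (y - t)))\<^sup>2) has_integral v) {0..1}"
    "v \<le> 32 / (real n + 2)\<^sup>2" using jackson_kernel by blast
  have f01: "continuous_on {0..1} f" using f continuous_on_subset by blast
  have "cmod (f y - (\<Sum>k\<in>?I. \<kappa> k * fourier_coeff f k * echar k y)) \<le> a + 32 * b / (real n + 2)\<^sup>2" for y
  proof -
    have "((\<lambda>t. f t * echar (-k) t) has_integral fourier_coeff f k) {0..1}" for k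
      unfolding fourier_coeff_def echar_exp_minus
      using f01 by (intro integrable_integral integrable_continuous_interval continuous_intros) auto
    then have "((\<lambda>t. \<Sum>k\<in>?I. (\<kappa> k * echar k y) * (f t * echar (-k) t)) has_integral
        (\<Sum>k\<in>?I. (\<kappa> k * echar k y) * fourier_coeff f k)) {0..1}"
      by (intro has_integral_sum has_integral_mult_right) auto
    moreover have "(\<Sum>k\<in>?I. (\<kappa> k * echar k y) * (f t * echar (-k) t)) = f t * complex_of_real (K (y - t))" for t
      unfolding K(2) echar_diff_arg by (simp add: sum_distrib_left mult_ac)
    ultimately have conv: "((\<lambda>t. f t * complex_of_real (K (y - t))) has_integral
        (\<Sum>k\<in>?I. \<kappa> k * fourier_coeff f k * echar k y)) {0..1}" by (simp add: mult_ac)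
    have "((\<lambda>t. complex_of_real (K (y - t))) has_integral complex_of_real 1) {0..1}"
      using has_integral_linear[OF K(4)[of y] bounded_linear_of_real] by (simp add: o_def)
    from has_integral_diff[OF has_integral_mult_right[OF this, of "f y"] conv]
    have diff: "((\<lambda>t. (f y - f t) * complex_of_real (K (y - t))) has_integral
        (f y - (\<Sum>k\<in>?I. \<kappa> k * fourier_coeff f k * echar k y))) {0..1}" by (simp add: left_diff_distrib)
    from has_integral_add[OF has_integral_mult_right[OF K(4)[of y], of a] has_integral_mult_right[OF K(5)[of y], of b]]
    have maj: "((\<lambda>t. a * K (y - t) + b * (K (y - t) * (cmod (1 - echar 1 (y - t)))\<^sup>2)) has_integral a + b * v) {0..1}"
      by simp
    have "cmod ((f y - f t) * complex_of_real (K (y - t)))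
       \<le> a * K (y - t) + b * (K (y - t) * (cmod (1 - echar 1 (y - t)))\<^sup>2)" for t
      using mult_right_mono[OF bound[of y t] K(1)[of "y - t"]] K(1)[of "y - t"]
      by (simp add: norm_mult distrib_left distrib_right mult_ac)
    then have "cmod (integral {0..1} (\<lambda>t. (f y - f t) * complex_of_real (K (y - t))))
      \<le> integral {0..1} (\<lambda>t. a * K (y - t) + b * (K (y - t) * (cmod (1 - echar 1 (y - t)))\<^sup>2))"
      using diff maj by (intro integral_norm_bound_integral) blast+
    then have "cmod (f y - (\<Sum>k\<in>?I. \<kappa> k * fourier_coeff f k * echar k y)) \<le> a + b * v"
      unfolding integral_unique[OF diff] integral_unique[OF maj] .
    also have "\<dots> \<le> a + b * (32 / (real n + 2)\<^sup>2)" using mult_left_mono[OF K(6) \<open>b \<ge> 0\<close>] by simp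
    finally show ?thesis by (simp add: mult.commute)
  qed
  with K(3) show ?thesis by (intro exI[of _ \<kappa>]) simp
qed

section \<open>Approximation of smooth functions\<close>

lemma periodic1_int:
  assumes "periodic1 f"
  shows "f (t + of_int m) = f t"
proof (induction m rule: int_induct[where k = 0])
  case (step1 i)
  then show ?case using assms[unfolded periodic1_def, rule_format, of "t + of_int i"] by (simp add: add.assoc)
next
  case (step2 i)
  then show ?case using assms[unfolded periodic1_def, rule_format, of "t + of_int (i - 1)"] by (simp add: add.assoc)
qed simp

lemma periodic1_bounded:
  assumes "continuous_on UNIV f" "periodic1 f"
  obtains M where "\<And>t. cmod (f t) \<le> M" "M > 0"
proof -
  have "compact (f ` {0..1})"
    using assms(1) by (intro compact_continuous_image) (auto intro: continuous_on_subset)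
  then obtain M where M: "M > 0" "\<And>z. z \<in> f ` {0..1} \<Longrightarrow> cmod z \<le> M"
    using compact_imp_bounded bounded_pos by metis
  have "cmod (f t) \<le> M" for t
  proof -
    have "f (t + of_int (- \<lfloor>t\<rfloor>)) = f t" by (rule periodic1_int[OF assms(2)])
    moreover have "t + of_int (- \<lfloor>t\<rfloor>) \<in> {0..1}" by simp linarith
    ultimately show ?thesis using M(2) by (metis imageI)
  qed
  with M(1) show thesis using that by blast
qed

lemma periodic1_deriv:
  assumes "periodic1 f" "\<And>t. (f has_vector_derivative f' t) (at t)"
  shows "periodic1 f'"
  unfolding periodic1_def
proof
  fix t
  have "((f \<circ> (\<lambda>t. t + 1)) has_vector_derivative (1 *\<^sub>R f' (t + 1))) (at t)"
    by (rule vector_diff_chain_at[OF _ assms(2)]) (auto intro!: derivative_eq_intros)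
  moreover have "f \<circ> (\<lambda>t. t + 1) = f" using assms(1) by (auto simp: periodic1_def)
  ultimately show "f' (t + 1) = f' t" using assms(2)[of t] vector_derivative_unique_at by fastforce
qed

text \<open>At distance w, the factor w^\<alpha> equals n^(-\<alpha>) (n w)^\<alpha>, and (n
  w)^\<alpha> \<le> 1 + (n w)^2: the first term covers n w \<le> 1, the second n w > 1. The scale
  1/n balances the two contributions.\<close>

lemma hoelder_trig_approx:
  assumes f: "continuous_on UNIV f" "periodic1 f" and \<alpha>: "0 < \<alpha>" "\<alpha> \<le> 1" and n: "n \<ge> 1"
    and M: "\<And>s t. cmod (f s - f t) \<le> M * \<bar>s - t\<bar> powr \<alpha>"
  shows "\<exists>p. trig_poly n p \<and> (\<forall>t. cmod (f t - p t) \<le> 33 * M * real n powr (- \<alpha>))"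
proof -
  have M0: "M \<ge> 0" using order_trans[OF norm_ge_zero M[of 1 0]] by simp
  define a where "a = M * real n powr (- \<alpha>)"
  have a0: "a \<ge> 0" using M0 by (simp add: a_def)
  have bound: "cmod (f y - f t) \<le> a + (a * (real n)\<^sup>2) * (cmod (1 - echar 1 (y - t)))\<^sup>2" for y t
  proof -
    obtain m :: int where m: "\<bar>(y - t) - of_int m\<bar> \<le> cmod (1 - echar 1 (y - t))"
      using torus_distance .
    define w where "w = \<bar>(y - t) - of_int m\<bar>"
    have nw: "(real n * w) powr \<alpha> \<le> 1 + (real n * w)\<^sup>2"
    proof (cases "real n * w \<le> 1")
      case True
      then have "(real n * w) powr \<alpha> \<le> 1" using \<alpha> by (intro powr_le1) (auto simp: w_def)
      then show ?thesis by (simp add: add_increasing2)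
    next
      case False
      then have "(real n * w) powr \<alpha> \<le> (real n * w) powr 2" using \<alpha> by (intro powr_mono) auto
      also have "\<dots> = (real n * w)\<^sup>2" using False by (intro powr_numeral) auto
      finally show ?thesis by simp
    qed
    have "cmod (f y - f t) = cmod (f y - f (t + of_int m))" by (simp add: periodic1_int[OF f(2)])
    also have "\<dots> \<le> M * w powr \<alpha>" using M[of y "t + of_int m"] by (simp add: w_def algebra_simps)
    also have "w powr \<alpha> = real n powr (- \<alpha>) * (real n * w) powr \<alpha>"
      using n by (simp add: powr_mult w_def powr_minus field_simps)
    also have "M * \<dots> \<le> M * (real n powr (- \<alpha>) * (1 + (real n * w)\<^sup>2))"
      using nw M0 by (intro mult_left_mono) auto
    also have "\<dots> = a + (a * (real n)\<^sup>2) * w\<^sup>2" by (simp add: a_def algebra_simps power_mult_distrib)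
    also have "\<dots> \<le> a + (a * (real n)\<^sup>2) * (cmod (1 - echar 1 (y - t)))\<^sup>2"
      using m a0 by (intro add_left_mono mult_left_mono power_mono) (auto simp: w_def)
    finally show ?thesis .
  qed
  have b0: "0 \<le> a * (real n)\<^sup>2" using a0 by simp
  obtain \<kappa> where \<kappa>: "\<And>y. cmod (f y - (\<Sum>k\<in>{- int n..int n}. \<kappa> k * fourier_coeff f k * echar k y))
        \<le> a + 32 * (a * (real n)\<^sup>2) / (real n + 2)\<^sup>2" 
    using jackson_approx[OF f(1) b0 bound, of n] by auto
  \<comment> \<open>Hence 33 = 1 + 32: one from the constant part and 32 from the second
    moment.\<close>
  have "(real n)\<^sup>2 / (real n + 2)\<^sup>2 \<le> 1" by (simp add: power_mono)
  from mult_left_mono[OF this, of "32 * a"] a0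
  have "a + 32 * (a * (real n)\<^sup>2) / (real n + 2)\<^sup>2 \<le> 33 * a" by simp
  then have "cmod (f y - (\<Sum>k\<in>{- int n..int n}. \<kappa> k * fourier_coeff f k * echar k y)) \<le> 33 * M * real n powr (- \<alpha>)" for y
    using order_trans[OF \<kappa>] by (simp add: a_def mult.assoc)
  then show ?thesis
    by (intro exI[of _ "\<lambda>y. \<Sum>k\<in>{- int n..int n}. \<kappa> k * fourier_coeff f k * echar k y"])
       (simp add: trig_poly_echar_sum)
qed

text \<open>Integrate p without its mean to obtain P. Then f - P has derivative f' - p plus the mean
  of p, and that mean is at most \<delta> because f' has mean zero. So f - P is Lipschitz with
  constant 2\<delta>, and the Hoelder case with exponent 1 gives 33 times 2\<delta> / n.\<close>

lemma deriv_trig_approx: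
  assumes f: "periodic1 f" "\<And>t. (f has_vector_derivative f' t) (at t)" and n: "n \<ge> 1"
    and p: "trig_poly n p" and \<delta>: "\<And>t. cmod (f' t - p t) \<le> \<delta>"
  shows "\<exists>q. trig_poly n q \<and> (\<forall>t. cmod (f t - q t) \<le> 66 * \<delta> / real n)"
proof -
  let ?I = "{- int n..int n}"
  have \<delta>0: "0 \<le> \<delta>" using \<delta>[of 0] norm_ge_zero order_trans by blast
  obtain c where c: "p = (\<lambda>t. \<Sum>k\<in>?I. c k * echar k t)" using p by (rule trig_polyE)
  have "(f' has_integral (f 1 - f 0)) {0..1}"
    using f(2) by (intro fundamental_theorem_of_calculus) (auto intro: has_vector_derivative_at_within)
  moreover have "f 1 = f 0" using f(1)[unfolded periodic1_def, rule_format, of 0] by simp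
  ultimately have f'0: "(f' has_integral 0) {0..1}" by simp
  have "((\<lambda>t. p t * echar (-0) t) has_integral c 0) {0..0+1}"
    unfolding c by (rule has_integral_echar_coeff) auto
  then have "(p has_integral c 0) {0..1}" by simp
  from has_integral_diff[OF f'0 this] have "((\<lambda>t. f' t - p t) has_integral - c 0) (cbox 0 1)" by simp
  from has_integral_bound[OF \<delta>0 this] \<delta> have c0: "cmod (c 0) \<le> \<delta>" by simp
  define P where "P t = (\<Sum>k\<in>?I. (if k = 0 then 0 else c k / (2 * pi * \<i> * of_int k)) * echar k t)" for t
  have P: "trig_poly n P" unfolding P_def by (rule trig_poly_echar_sum)
  have P': "(P has_vector_derivative (p t - c 0)) (at t)" for t
  proof -
    have "(P has_vector_derivative
        (\<Sum>k\<in>?I. (if k = 0 then 0 else c k / (2 * pi * \<i> * of_int k)) * (2 * pi * \<i> * of_int k * echar k t))) (at t)"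
      unfolding P_def
      by (intro has_vector_derivative_sum has_vector_derivative_mult_right has_vector_derivative_echar)
    also have "(\<Sum>k\<in>?I. (if k = 0 then 0 else c k / (2 * pi * \<i> * of_int k)) * (2 * pi * \<i> * of_int k * echar k t))
        = (\<Sum>k\<in>?I. c k * echar k t - (if k = 0 then c 0 else 0))"
      by (intro sum.cong) auto
    also have "\<dots> = p t - c 0" unfolding c by (simp add: sum_subtractf)
    finally show ?thesis .
  qed
  define g where "g t = f t - P t" for t
  define g' where "g' t = f' t - (p t - c 0)" for t
  have g': "(g has_vector_derivative g' t) (at t)" for t
    unfolding g_def g'_def by (intro has_vector_derivative_diff f P')
  have g'_le: "cmod (g' t) \<le> 2 * \<delta>" for t
    using norm_triangle_ineq[of "f' t - p t" "c 0"] \<delta>[of t] c0 by (simp add: g'_def diff_diff_eq2 diff_add_eq)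
  have "periodic1 g" using f(1) trig_poly_plus_one[OF P] unfolding periodic1_def g_def by simp
  moreover have "continuous_on UNIV g"
    using g' has_vector_derivative_continuous continuous_at_imp_continuous_on by blast
  moreover have "cmod (g s - g t) \<le> (2 * \<delta>) * \<bar>s - t\<bar> powr 1" for s t
  proof -
    have "norm (g s - g t) \<le> (2 * \<delta>) * norm (s - t)"
    proof (rule differentiable_bound[of UNIV g "\<lambda>t h. h *\<^sub>R g' t"])
      show "onorm (\<lambda>h. h *\<^sub>R g' u) \<le> 2 * \<delta>" for u
        using g'_le[of u] by (intro onorm_le) (simp add: mult.commute mult_left_mono)
    qed (use g' in \<open>auto simp: has_vector_derivative_def\<close>)
    then show ?thesis by simp
  qed
  ultimately obtain r where r: "trig_poly n r" "\<And>t. cmod (g t - r t) \<le> 33 * (2 * \<delta>) * real n powr (- 1)"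
    using hoelder_trig_approx[of g 1 n "2 * \<delta>"] n by auto
  have "cmod (f t - (P t + r t)) \<le> 66 * \<delta> / real n" for t
    using r(2)[of t] n by (simp add: g_def algebra_simps powr_minus_divide)
  then show ?thesis using trig_poly_add[OF P r(1)] by blast
qed

text \<open>Descending induction from the highest derivative: \<open>D j\<close> is approximated at
  rate n^(j - \<sigma>), and each step down gains a factor 1/n and multiplies the constant by
  66.\<close>

lemma C_sigma_trig_approx:
  assumes "\<sigma> \<ge> 0" "C_sigma \<sigma> f"
  obtains C where "\<And>n. n \<ge> 1 \<Longrightarrow> \<exists>p. trig_poly n p \<and> (\<forall>t. cmod (f t - p t) \<le> C * real n powr (- \<sigma>))"
    and "continuous_on UNIV f"
proof -
  define r where "r = nat \<lfloor>\<sigma>\<rfloor>"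
  define \<alpha> where "\<alpha> = \<sigma> - of_int \<lfloor>\<sigma>\<rfloor>"
  have r: "real r = \<sigma> - \<alpha>" using assms(1) by (simp add: r_def \<alpha>_def)
  have \<alpha>: "0 \<le> \<alpha>" "\<alpha> < 1" unfolding \<alpha>_def by linarith+
  obtain D where D: "D 0 = f" "\<And>j t. j < r \<Longrightarrow> (D j has_vector_derivative D (Suc j) t) (at t)"
    "continuous_on UNIV (D r)" "\<alpha> > 0 \<Longrightarrow> \<exists>M. \<forall>s t. cmod (D r s - D r t) \<le> M * \<bar>s - t\<bar> powr \<alpha>"
    and f: "periodic1 f"
    using assms(2) unfolding C_sigma_def r_def \<alpha>_def by blast
  have per: "periodic1 (D j)" if "j \<le> r" for j
    using that by (induction j) (use D f periodic1_deriv in \<open>auto simp: Suc_le_eq\<close>)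
  have "continuous_on UNIV f"
  proof (cases "r = 0")
    case False
    then show ?thesis using D(1) D(2)[of 0] has_vector_derivative_continuous
      continuous_at_imp_continuous_on by blast
  qed (use D in auto)
  moreover have "\<exists>C. \<forall>n\<ge>1. \<exists>p. trig_poly n p \<and> (\<forall>t. cmod (D 0 t - p t) \<le> C * real n powr (real 0 - \<sigma>))"
  proof (rule inc_induct[of 0 r])
    show "\<exists>C. \<forall>n\<ge>1. \<exists>p. trig_poly n p \<and> (\<forall>t. cmod (D r t - p t) \<le> C * real n powr (real r - \<sigma>))"
    proof (cases "\<alpha> = 0")
      case True
      \<comment> \<open>For integral \<sigma> the top derivative is only continuous, but the rate
        asked of it is n^0, so boundedness and the zero polynomial suffice.\<close>
      obtain M where "\<And>t. cmod (D r t) \<le> M" using periodic1_bounded[OF D(3) per] by blast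
      then have "\<exists>p. trig_poly n p \<and> (\<forall>t. cmod (D r t - p t) \<le> M * real n powr (real r - \<sigma>))" if "n \<ge> 1" for n
        using that True r by (intro exI[of _ "\<lambda>t. 0"]) simp
      then show ?thesis by blast
    next
      case False
      then obtain M where M: "\<And>s t. cmod (D r s - D r t) \<le> M * \<bar>s - t\<bar> powr \<alpha>" using D(4) \<alpha> by force
      have "real r - \<sigma> = - \<alpha>" using r by simp
      then show ?thesis using hoelder_trig_approx[OF D(3) per _ _ _ M] False \<alpha>
        by (intro exI[of _ "33 * M"]) simp
    qed
  next
    fix j assume j: "j < r" and
      "\<exists>C. \<forall>n\<ge>1. \<exists>p. trig_poly n p \<and> (\<forall>t. cmod (D (Suc j) t - p t) \<le> C * real n powr (real (Suc j) - \<sigma>))"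
    then obtain C where C: "\<And>n. n \<ge> 1 \<Longrightarrow> \<exists>p. trig_poly n p \<and> (\<forall>t. cmod (D (Suc j) t - p t) \<le> C * real n powr (real (Suc j) - \<sigma>))"
      by blast
    have "\<exists>p. trig_poly n p \<and> (\<forall>t. cmod (D j t - p t) \<le> 66 * C * real n powr (real j - \<sigma>))" if n: "n \<ge> 1" for n
    proof -
      obtain p where p: "trig_poly n p" "\<And>t. cmod (D (Suc j) t - p t) \<le> C * real n powr (real (Suc j) - \<sigma>)"
        using C[OF n] by blast
      have "real n powr (real (Suc j) - \<sigma>) = real n powr (real j - \<sigma>) * real n"
        using n powr_add[of "real n" "real j - \<sigma>" 1] by (simp add: algebra_simps)
      then have "66 * (C * real n powr (real (Suc j) - \<sigma>)) / real n = 66 * C * real n powr (real j - \<sigma>)"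
        using n by simp
      with deriv_trig_approx[OF per[of j] D(2)[OF j] n p] j show ?thesis by auto
    qed
    then show "\<exists>C. \<forall>n\<ge>1. \<exists>p. trig_poly n p \<and> (\<forall>t. cmod (D j t - p t) \<le> C * real n powr (real j - \<sigma>))"
      by blast
  qed simp
  ultimately show thesis using that D(1) by auto
qed

section \<open>Approximation by Fourier tails\<close>

text \<open>Near the diagonal uniform continuity gives \<epsilon>. Away from it the chord is at
  least d', so the trivial bound 2M is at most b times the squared chord for b = 2M / d'^2.\<close>

lemma periodic1_modulus:
  assumes f: "continuous_on UNIV f" "periodic1 f" and "\<epsilon> > 0"
  obtains b where "b \<ge> 0" "\<And>y t. cmod (f y - f t) \<le> \<epsilon> + b * (cmod (1 - echar 1 (y - t)))\<^sup>2"
proof -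
  obtain M where M: "\<And>t. cmod (f t) \<le> M" "M > 0" using periodic1_bounded[OF f] by blast
  have "uniformly_continuous_on {-1..2} f"
    using f(1) by (intro compact_uniformly_continuous) (auto intro: continuous_on_subset)
  then obtain d where d: "d > 0" "\<And>s t. s \<in> {-1..2} \<Longrightarrow> t \<in> {-1..2} \<Longrightarrow> dist t s < d \<Longrightarrow> dist (f t) (f s) < \<epsilon>"
    unfolding uniformly_continuous_on_def using \<open>\<epsilon> > 0\<close> by metis
  define d' where "d' = min d 1"
  have d': "d' > 0" using d(1) by (simp add: d'_def)
  define b where "b = 2 * M / d'\<^sup>2"
  have b: "b \<ge> 0" using M(2) by (simp add: b_def)
  have "cmod (f y - f t) \<le> \<epsilon> + b * (cmod (1 - echar 1 (y - t)))\<^sup>2" for y t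
  proof -
    obtain m :: int where m: "\<bar>(y - t) - of_int m\<bar> \<le> cmod (1 - echar 1 (y - t))"
      using torus_distance .
    define w where "w = \<bar>(y - t) - of_int m\<bar>"
    show ?thesis
    proof (cases "w < d'")
      case True
      \<comment> \<open>Moving y into [0, 1] and t along with it, up to the nearest-integer shift,
        preserves w. Since d' \<le> 1, both points lie in [-1, 2], where uniform continuity is
        available.\<close>
      define y' t' where "y' = y + of_int (- \<lfloor>y\<rfloor>)" and "t' = t + of_int (m - \<lfloor>y\<rfloor>)"
      have w: "w = \<bar>y' - t'\<bar>" unfolding w_def y'_def t'_def by simp
      have "0 \<le> y'" "y' \<le> 1" unfolding y'_def by (simp, linarith)+
      moreover have "\<bar>y' - t'\<bar> < 1" "\<bar>y' - t'\<bar> < d" using True w by (auto simp: d'_def)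
      ultimately have "dist (f y') (f t') < \<epsilon>" using d by (intro d(2)) (auto simp: dist_real_def)
      moreover have "f y' = f y" "f t' = f t" unfolding y'_def t'_def by (rule periodic1_int[OF f(2)])+
      ultimately have "cmod (f y - f t) \<le> \<epsilon>" by (simp add: dist_norm)
      then show ?thesis using b by (simp add: add_increasing2)
    next
      case False
      then have "d'\<^sup>2 \<le> (cmod (1 - echar 1 (y - t)))\<^sup>2" using d' m unfolding w_def by (intro power_mono) auto
      then have "2 * M * 1 \<le> 2 * M * ((cmod (1 - echar 1 (y - t)))\<^sup>2 / d'\<^sup>2)"
        using d' M(2) by (intro mult_left_mono) auto
      moreover have "cmod (f y - f t) \<le> 2 * M" using norm_triangle_ineq4[of "f y" "f t"] M(1)[of y] M(1)[of t] by simp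
      ultimately show ?thesis using \<open>\<epsilon> > 0\<close> by (simp add: b_def)
    qed
  qed
  with b show thesis using that by blast
qed

text \<open>
  Because the multipliers of the kernel are at most 1 in modulus, the tail of the Fourier
  coefficients controls the best approximation even without knowing that the Fourier series
  converges to \<open>f\<close>.
\<close>

lemma fourier_tail_trig_approx:
  assumes f: "continuous_on UNIV f" "periodic1 f" and "\<epsilon> > 0"
    and T: "\<And>N. (\<Sum>k\<in>{- int N..int N} - {- int n..int n}. cmod (fourier_coeff f k)) \<le> T"
  shows "\<exists>p. trig_poly n p \<and> (\<forall>t. cmod (f t - p t) \<le> \<epsilon> + T)"
proof -
  obtain b where b: "b \<ge> 0" "\<And>y t. cmod (f y - f t) \<le> \<epsilon> / 2 + b * (cmod (1 - echar 1 (y - t)))\<^sup>2"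
    using periodic1_modulus[OF f, of "\<epsilon> / 2"] \<open>\<epsilon> > 0\<close> by auto
  obtain N0 :: nat where N0: "64 * b / \<epsilon> \<le> real N0" using real_arch_simple by blast
  define N where "N = max N0 n"
  let ?I = "{- int n..int n}" and ?J = "{- int N..int N}"
  have "64 * b / \<epsilon> \<le> real N" using N0 by (simp add: N_def)
  also have "\<dots> \<le> (real N + 2)\<^sup>2" by (simp add: power2_eq_square algebra_simps)
  finally have Nb: "32 * b / (real N + 2)\<^sup>2 \<le> \<epsilon> / 2" using \<open>\<epsilon> > 0\<close> by (simp add: field_simps)
  obtain \<kappa> where \<kappa>: "\<forall>k\<in>?J. cmod (\<kappa> k) \<le> 1"
    "\<forall>y. cmod (f y - (\<Sum>k\<in>?J. \<kappa> k * fourier_coeff f k * echar k y)) \<le> \<epsilon> / 2 + 32 * b / (real N + 2)\<^sup>2"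
    using jackson_approx[OF f(1) b, of N] by (elim exE conjE)
  \<comment> \<open>A smoothing of large degree N is cut down to degree n: the smoothing error is
    made small by N, and the discarded frequencies cost at most T.\<close>
  define p where "p y = (\<Sum>k\<in>?I. \<kappa> k * fourier_coeff f k * echar k y)" for y
  have "cmod (f y - p y) \<le> \<epsilon> + T" for y
  proof -
    have "(\<Sum>k\<in>?J. \<kappa> k * fourier_coeff f k * echar k y)
        = (\<Sum>k\<in>?J - ?I. \<kappa> k * fourier_coeff f k * echar k y) + p y"
      unfolding p_def by (rule sum.subset_diff) (auto simp: N_def)
    then have "f y - p y = (f y - (\<Sum>k\<in>?J. \<kappa> k * fourier_coeff f k * echar k y))
        + (\<Sum>k\<in>?J - ?I. \<kappa> k * fourier_coeff f k * echar k y)" by simp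
    also have "cmod \<dots> \<le> (\<epsilon> / 2 + 32 * b / (real N + 2)\<^sup>2) + (\<Sum>k\<in>?J - ?I. cmod (fourier_coeff f k))"
    proof (intro norm_triangle_mono \<kappa>(2)[rule_format] sum_norm_le)
      fix k assume "k \<in> ?J - ?I"
      then show "cmod (\<kappa> k * fourier_coeff f k * echar k y) \<le> cmod (fourier_coeff f k)"
        using \<kappa>(1) by (simp add: norm_mult mult_left_le_one_le)
    qed
    also have "\<dots> \<le> \<epsilon> + T" using Nb T[of N] by linarith
    finally show ?thesis .
  qed
  moreover have "trig_poly n p" unfolding p_def by (rule trig_poly_echar_sum)
  ultimately show ?thesis by blast
qed

text \<open>The approximants reach T only up to a positive slack, which is scaled by the constant
  and sent to zero. Bounding all finite partial sums by \<open>T\<close> expresses the tail estimate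
  without an infinite sum.\<close>

lemma quad_error_fourier_tail:
  assumes MZ: "MZ_family L x \<tau> A B" "n \<ge> 1" and f: "continuous_on UNIV f" "periodic1 f"
    and T: "\<And>N. (\<Sum>k\<in>{- int N..int N} - {- int n..int n}. cmod (fourier_coeff f k)) \<le> T"
  shows "cmod (integral {-1/2..1/2} f - quad L x \<tau> n f) \<le> (1 + sqrt (B / A)) * T"
proof (rule field_le_epsilon)
  fix e :: real assume "e > 0"
  let ?c = "1 + sqrt (B / A)"
  have c: "?c > 0" using MZ(1) by (simp add: MZ_family_def add_pos_nonneg)
  obtain p where "trig_poly n p" "\<And>t. cmod (f t - p t) \<le> e / ?c + T"
    using fourier_tail_trig_approx[OF f _ T, of "e / ?c"] \<open>e > 0\<close> c by auto
  from quad_error_le[OF MZ f(1) this]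
  have "cmod (integral {-1/2..1/2} f - quad L x \<tau> n f) \<le> ?c * (e / ?c + T)" .
  also have "\<dots> = ?c * T + e" using c by (simp add: distrib_left)
  finally show "cmod (integral {-1/2..1/2} f - quad L x \<tau> n f) \<le> ?c * T + e" .
qed

section \<open>Fourier tails of Sobolev functions\<close>

lemma sum_symmetric_annulus:
  fixes g :: "nat \<Rightarrow> real"
  shows "(\<Sum>k\<in>{- int N..int N} - {- int n..int n}. g (nat \<bar>k\<bar>)) = 2 * (\<Sum>k\<in>{n<..N}. g k)"
proof -
  have "{- int N..int N} - {- int n..int n} = int ` {n<..N} \<union> (\<lambda>k. - int k) ` {n<..N}" (is "_ = ?A \<union> ?B")
  proof (intro equalityI subsetI)
    fix k assume k: "k \<in> {- int N..int N} - {- int n..int n}"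
    show "k \<in> ?A \<union> ?B"
    proof (cases "k \<ge> 0")
      case True
      then have "k = int (nat k)" "nat k \<in> {n<..N}" using k by auto
      then show ?thesis by blast
    next
      case False
      then have "k = - int (nat (- k))" "nat (- k) \<in> {n<..N}" using k by auto
      then show ?thesis by blast
    qed
  qed auto
  moreover have "sum (\<lambda>k. g (nat \<bar>k\<bar>)) (?A \<union> ?B) = sum (\<lambda>k. g (nat \<bar>k\<bar>)) ?A + sum (\<lambda>k. g (nat \<bar>k\<bar>)) ?B"
    by (rule sum.union_disjoint) auto
  moreover have "sum (\<lambda>k. g (nat \<bar>k\<bar>)) ?A = (\<Sum>k\<in>{n<..N}. g k)"
    by (subst sum.reindex) (auto simp: inj_on_def)
  moreover have "sum (\<lambda>k. g (nat \<bar>k\<bar>)) ?B = (\<Sum>k\<in>{n<..N}. g k)"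
    by (subst sum.reindex) (auto simp: inj_on_def)
  ultimately show ?thesis by simp
qed

text \<open>Comparison with the integral of t^(-s-1), done by telescoping: the mean value theorem
  bounds s (k+1)^(-s-1) by k^(-s) - (k+1)^(-s).\<close>

lemma sum_powr_tail_le:
  assumes "s > 0" "n \<ge> 1"
  shows "(\<Sum>k\<in>{n<..N}. real k powr (- s - 1)) \<le> real n powr (- s) / s"
proof -
  have step: "real (Suc k) powr (- s - 1) \<le> (real k powr (- s) - real (Suc k) powr (- s)) / s" if "k \<ge> 1" for k
  proof -
    have "\<exists>z>real k. z < real (Suc k) \<and> real (Suc k) powr (- s) - real k powr (- s)
        = (real (Suc k) - real k) * (- s * z powr (- s - 1))"
      by (rule MVT2) (use that in \<open>auto intro!: derivative_eq_intros\<close>)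
    then obtain z where z: "z > real k" "z < real (Suc k)"
      "real k powr (- s) - real (Suc k) powr (- s) = s * z powr (- s - 1)" by auto
    have "real (Suc k) powr (- s - 1) \<le> z powr (- s - 1)"
      using z that assms by (intro powr_mono2') auto
    then show ?thesis unfolding z(3) using assms by simp
  qed
  have "(\<Sum>k\<in>{n<..N}. real k powr (- s - 1)) \<le> (real n powr (- s) - real N powr (- s)) / s" if "n \<le> N"
    using that
  proof (induction N rule: dec_induct)
    case (step m)
    have "{n<..Suc m} = insert (Suc m) {n<..m}" using step by auto
    moreover have "real (Suc m) powr (- s - 1) \<le> (real m powr (- s) - real (Suc m) powr (- s)) / s"
      using step assms by (intro \<open>\<And>k. k \<ge> 1 \<Longrightarrow> real (Suc k) powr (- s - 1) \<le> _\<close>) simp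
    ultimately show ?case using step by (simp add: diff_divide_distrib)
  qed simp
  moreover have "(real n powr (- s) - real N powr (- s)) / s \<le> real n powr (- s) / s"
    using assms by (intro divide_right_mono) auto
  moreover have "0 \<le> real n powr (- s) / s" using assms by simp
  ultimately show ?thesis by (cases "n \<le> N") auto
qed

text \<open>The Cauchy-Schwarz inequality with weight (1 + k^2)^(\<sigma>/2) leaves the tail of (1 +
  k^2)^(-\<sigma>) \<le> |k|^(-2\<sigma>). Summed over both signs it is at most 2 n^(-(2\<sigma>-1))
  / (2\<sigma>-1), which is exactly the square of \<open>phi_sigma\<close>. The exponent is written
  \<open>- (2 * \<sigma> - 1) - 1\<close> to fit the tail bound with s = 2\<sigma> - 1.\<close>

lemma H_sigma_fourier_tail:
  assumes "\<sigma> > 1/2" "in_H_sigma \<sigma> f" "n \<ge> 1"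
  shows "(\<Sum>k\<in>{- int N..int N} - {- int n..int n}. cmod (fourier_coeff f k)) \<le> H_sigma_norm \<sigma> f * phi_sigma \<sigma> n"
proof -
  let ?D = "{- int N..int N} - {- int n..int n}"
  define w :: "int \<Rightarrow> real" where "w k = 1 + (of_int k)\<^sup>2" for k
  have w: "w k > 0" for k unfolding w_def by (simp add: add_pos_nonneg)
  define H where "H = (\<Sum>\<^sub>\<infinity>k::int. (cmod (fourier_coeff f k))\<^sup>2 * w k powr \<sigma>)"
  have "H \<ge> 0" unfolding H_def by (rule infsum_nonneg) simp
  have eq: "(\<Sum>k\<in>?D. cmod (fourier_coeff f k))
      = (\<Sum>k\<in>?D. (cmod (fourier_coeff f k) * w k powr (\<sigma> / 2)) * w k powr (- \<sigma> / 2))"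
    using w by (intro sum.cong refl) (simp add: powr_minus mult.assoc less_imp_neq[THEN not_sym])
  have "(\<Sum>k\<in>?D. cmod (fourier_coeff f k))\<^sup>2
      \<le> (\<Sum>k\<in>?D. (cmod (fourier_coeff f k) * w k powr (\<sigma> / 2))\<^sup>2) * (\<Sum>k\<in>?D. (w k powr (- \<sigma> / 2))\<^sup>2)"
    unfolding eq by (rule Cauchy_Schwarz_ineq_sum)
  also have "\<dots> \<le> H * (2 * (real n powr (- (2 * \<sigma> - 1)) / (2 * \<sigma> - 1)))"
  proof (rule mult_mono)
    have "(\<Sum>k\<in>?D. (cmod (fourier_coeff f k) * w k powr (\<sigma> / 2))\<^sup>2) = (\<Sum>k\<in>?D. (cmod (fourier_coeff f k))\<^sup>2 * w k powr \<sigma>)"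
      by (intro sum.cong refl) (simp add: power_mult_distrib power2_eq_square[of "_ powr _"] flip: powr_add)
    also have "\<dots> \<le> H"
      unfolding H_def using assms(2) unfolding in_H_sigma_def w_def by (intro finite_sum_le_infsum) auto
    finally show "(\<Sum>k\<in>?D. (cmod (fourier_coeff f k) * w k powr (\<sigma> / 2))\<^sup>2) \<le> H" .
    have "(\<Sum>k\<in>?D. (w k powr (- \<sigma> / 2))\<^sup>2) \<le> (\<Sum>k\<in>?D. real (nat \<bar>k\<bar>) powr (- (2 * \<sigma> - 1) - 1))"
    proof (rule sum_mono)
      fix k assume k: "k \<in> ?D"
      then have k0: "\<bar>real_of_int k\<bar> > 0" by auto
      have "(w k powr (- \<sigma> / 2))\<^sup>2 = w k powr (- \<sigma>)"
        by (simp add: power2_eq_square flip: powr_add)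
      also have "\<dots> \<le> (\<bar>real_of_int k\<bar> powr 2) powr (- \<sigma>)"
        using k0 assms by (intro powr_mono2') (auto simp: w_def)
      also have "\<dots> = \<bar>real_of_int k\<bar> powr (- (2 * \<sigma> - 1) - 1)" unfolding powr_powr by simp
      finally show "(w k powr (- \<sigma> / 2))\<^sup>2 \<le> real (nat \<bar>k\<bar>) powr (- (2 * \<sigma> - 1) - 1)" by simp
    qed
    also have "\<dots> = 2 * (\<Sum>k\<in>{n<..N}. real k powr (- (2 * \<sigma> - 1) - 1))"
      by (rule sum_symmetric_annulus)
    also have "\<dots> \<le> 2 * (real n powr (- (2 * \<sigma> - 1)) / (2 * \<sigma> - 1))"
      using assms by (intro mult_left_mono sum_powr_tail_le) auto
    finally show "(\<Sum>k\<in>?D. (w k powr (- \<sigma> / 2))\<^sup>2) \<le> 2 * (real n powr (- (2 * \<sigma> - 1)) / (2 * \<sigma> - 1))" .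
  qed (auto intro: sum_nonneg \<open>H \<ge> 0\<close>)
  also have "\<dots> = (H_sigma_norm \<sigma> f * phi_sigma \<sigma> n)\<^sup>2"
  proof -
    have "(H_sigma_norm \<sigma> f)\<^sup>2 = H" unfolding H_sigma_norm_def H_def[unfolded w_def, symmetric]
      using \<open>H \<ge> 0\<close> by simp
    moreover have "(phi_sigma \<sigma> n)\<^sup>2 = (\<sigma> - 1/2) powr (- 1) * real n powr (- (2 * \<sigma> - 1))"
      unfolding phi_sigma_def power_mult_distrib by (simp add: power2_eq_square flip: powr_add)
    moreover have "(\<sigma> - 1/2) powr (- 1) = 2 / (2 * \<sigma> - 1)"
      using assms by (simp add: powr_minus_divide field_simps)
    ultimately show ?thesis unfolding power_mult_distrib by (simp only: times_divide_eq_left times_divide_eq_right)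
  qed
  finally show ?thesis
    by (rule power2_le_imp_le)
       (auto simp: H_sigma_norm_def phi_sigma_def intro!: mult_nonneg_nonneg infsum_nonneg)
qed

section \<open>Fourier tails of functions analytic in a strip\<close>

text \<open>A primitive P exists on the convex strip, and P(z + 1) - P(z) has derivative zero by
  periodicity. That constant is the integral over every horizontal unit segment, so the contour
  moves vertically without integrating around a rectangle.\<close>

lemma holomorphic_periodic_horizontal_integral:
  assumes g: "g holomorphic_on {z. \<bar>Im z\<bar> < \<rho>}" and per: "\<And>z. \<bar>Im z\<bar> < \<rho> \<Longrightarrow> g (z + 1) = g z"
  shows "\<exists>c. \<forall>y. \<bar>y\<bar> < \<rho> \<longrightarrow> ((\<lambda>t. g (Complex t y)) has_integral c) {0..1}"
proof -
  let ?S = "{z. \<bar>Im z\<bar> < \<rho>}"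
  have S: "?S = {z. Im z < \<rho>} \<inter> {z. Im z > - \<rho>}" by auto
  have conv: "convex ?S" unfolding S by (intro convex_Int convex_halfspace_Im_lt convex_halfspace_Im_gt)
  have op: "open ?S" unfolding S by (intro open_Int open_halfspace_Im_lt open_halfspace_Im_gt)
  obtain P where P: "\<And>z. z \<in> ?S \<Longrightarrow> (P has_field_derivative g z) (at z within ?S)"
    using holomorphic_convex_primitive'[OF conv op g] by blast
  then have P: "(P has_field_derivative g z) (at z)" if "z \<in> ?S" for z
    using that at_within_open[OF that op] by metis
  have "\<exists>c. \<forall>z\<in>?S. P (z + 1) - P z = c"
  proof (rule has_field_derivative_zero_constant[OF conv])
    fix z assume z: "z \<in> ?S"
    have "((\<lambda>z. P (z + 1)) has_field_derivative g (z + 1)) (at z)"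
      using P[of "z + 1"] z DERIV_shift[of P] by simp
    from DERIV_diff[OF this P[OF z]] show "((\<lambda>z. P (z + 1) - P z) has_field_derivative 0) (at z within ?S)"
      using per z by (simp add: has_field_derivative_at_within)
  qed
  then obtain c where c: "\<And>z. z \<in> ?S \<Longrightarrow> P (z + 1) - P z = c" by blast
  have "((\<lambda>t. g (Complex t y)) has_integral c) {0..1}" if y: "\<bar>y\<bar> < \<rho>" for y
  proof -
    have "((\<lambda>t. g (Complex t y)) has_integral (P (Complex 1 y) - P (Complex 0 y))) {0..1}"
    proof (rule fundamental_theorem_of_calculus)
      fix t :: real
      have "((\<lambda>t. complex_of_real t + \<i> * complex_of_real y) has_vector_derivative 1) (at t within {0..1})"
        by (auto intro!: derivative_eq_intros simp: has_vector_derivative_def scaleR_conv_of_real)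
      then have "((\<lambda>t. Complex t y) has_vector_derivative 1) (at t within {0..1})"
        by (simp add: complex_eq_iff Complex_eq)
      moreover have "(P has_field_derivative g (Complex t y)) (at (Complex t y) within (\<lambda>t. Complex t y) ` {0..1})"
        by (rule has_field_derivative_at_within[OF P]) (use y in simp)
      ultimately have "(P \<circ> (\<lambda>t. Complex t y) has_vector_derivative 1 * g (Complex t y)) (at t within {0..1})"
        by (rule field_vector_diff_chain_within)
      then show "((\<lambda>t. P (Complex t y)) has_vector_derivative g (Complex t y)) (at t within {0..1})"
        by (simp add: o_def)
    qed simp
    moreover have "Complex 1 y = Complex 0 y + 1" by (simp add: complex_eq_iff)
    ultimately show ?thesis using c[of "Complex 0 y"] y by simp
  qed
  then show ?thesis by blast
qed

text \<open>Periodicity is given on the real axis only; the identity theorem, applied to F(z + 1) -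
  F(z), carries it to the strip.\<close>

lemma holomorphic_strip_periodic:
  assumes F: "F holomorphic_on {z. \<bar>Im z\<bar> < \<rho>0}" and "0 < \<rho>0" and "periodic1 f" and "\<And>t. F (complex_of_real t) = f t"
    and z: "\<bar>Im z\<bar> < \<rho>0"
  shows "F (z + 1) = F z"
proof -
  let ?S = "{z. \<bar>Im z\<bar> < \<rho>0}"
  have S: "?S = {z. Im z < \<rho>0} \<inter> {z. Im z > - \<rho>0}" by auto
  have "convex ?S" unfolding S by (intro convex_Int convex_halfspace_Im_lt convex_halfspace_Im_gt)
  then have conn: "connected ?S" by (rule convex_connected)
  have op: "open ?S" unfolding S by (intro open_Int open_halfspace_Im_lt open_halfspace_Im_gt)
  have hol: "(\<lambda>z. F (z + 1) - F z) holomorphic_on ?S"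
  proof (intro holomorphic_intros F)
    have "F \<circ> (\<lambda>z. z + 1) holomorphic_on ?S"
      by (rule holomorphic_on_compose_gen[OF _ F]) (auto intro!: holomorphic_intros)
    then show "(\<lambda>z. F (z + 1)) holomorphic_on ?S" by (simp add: o_def)
  qed
  have lim: "(0::complex) islimpt range complex_of_real"
  proof -
    have "(0::complex) islimpt closed_segment 0 1" 
    proof (rule connected_imp_perfect)
      have "0 \<in> closed_segment 0 (1::complex)" "1 \<in> closed_segment 0 (1::complex)" by simp_all
      then show "closed_segment 0 1 \<noteq> {w}" for w :: complex by (metis singletonD zero_neq_one)
    qed auto
    moreover have "closed_segment 0 (1::complex) \<subseteq> range complex_of_real"
      by (auto simp: closed_segment_def scaleR_conv_of_real)
    ultimately show ?thesis by (rule islimpt_subset)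
  qed
  have zero: "F (w + 1) - F w = 0" if "w \<in> range complex_of_real" for w
  proof -
    from that obtain t where t: "w = complex_of_real t" by blast
    have "F (w + 1) = f (t + 1)" using assms(4)[of "t + 1"] by (simp add: t)
    then show ?thesis using assms(3,4) by (simp add: t periodic1_def)
  qed
  have "F (z + 1) - F z = 0"
    by (rule analytic_continuation[OF hol op conn _ _ lim zero]) (use \<open>0 < \<rho>0\<close> z in auto)
  then show ?thesis by simp
qed

text \<open>The line of integration is shifted to height \<rho> or -\<rho>, where the exponential
  factor is small. Taking \<rho> < \<rho>0 keeps a compact rectangle inside the strip, on which F is
  bounded by M.\<close>

lemma analytic_fourier_decay:
  assumes F: "F holomorphic_on {z. \<bar>Im z\<bar> < \<rho>0}" and \<rho>: "0 < \<rho>" "\<rho> < \<rho>0"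
    and f: "periodic1 f" "\<And>t. F (complex_of_real t) = f t"
  obtains M where "M \<ge> 0" "\<And>k. cmod (fourier_coeff f k) \<le> M * exp (- 2 * pi * \<rho>) ^ nat \<bar>k\<bar>"
proof -
  let ?S = "{z. \<bar>Im z\<bar> < \<rho>0}"
  have sub: "cbox (Complex 0 (-\<rho>)) (Complex 1 \<rho>) \<subseteq> ?S" using \<rho> by (auto simp: in_cbox_complex_iff)
  have "compact (F ` cbox (Complex 0 (-\<rho>)) (Complex 1 \<rho>))"
    using F sub by (intro compact_continuous_image compact_cbox) (auto intro: holomorphic_on_imp_continuous_on continuous_on_subset)
  then obtain M where M: "M > 0" "\<And>z. z \<in> F ` cbox (Complex 0 (-\<rho>)) (Complex 1 \<rho>) \<Longrightarrow> cmod z \<le> M"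
    using compact_imp_bounded bounded_pos by metis
  have "cmod (fourier_coeff f k) \<le> M * exp (- 2 * pi * \<rho>) ^ nat \<bar>k\<bar>" for k
  proof -
    define g where "g z = F z * exp (- 2 * pi * \<i> * of_int k * z)" for z
    have "g holomorphic_on ?S" unfolding g_def by (intro holomorphic_intros F)
    moreover have "g (z + 1) = g z" if "\<bar>Im z\<bar> < \<rho>0" for z
    proof -
      have "exp (- 2 * pi * \<i> * of_int k * (z + 1)) = exp (- 2 * pi * \<i> * of_int k * z) * echar (- k) 1"
        unfolding echar_exp_minus[symmetric] by (simp add: algebra_simps flip: exp_add)
      then show ?thesis using holomorphic_strip_periodic[OF F _ f that] \<rho> echar_int[of "-k" 1]
        by (simp add: g_def)
    qed
    ultimately obtain c where c: "\<And>y. \<bar>y\<bar> < \<rho>0 \<Longrightarrow> ((\<lambda>t. g (Complex t y)) has_integral c) {0..1}"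
      using holomorphic_periodic_horizontal_integral by blast
    have "((\<lambda>t. g (Complex t 0)) has_integral c) {0..1}" using c \<rho> by simp
    then have ck: "fourier_coeff f k = c"
      unfolding fourier_coeff_def g_def using f(2)
      by (intro integral_unique) (simp flip: complex_of_real_def)
    \<comment> \<open>On the line Im z = y the exponential has modulus exp (2 pi k y), so y takes
      the sign opposite to k.\<close>
    define y where "y = (if k \<ge> 0 then - \<rho> else \<rho>)"
    have gb: "cmod (g (Complex t y)) \<le> M * exp (- 2 * pi * \<rho>) ^ nat \<bar>k\<bar>" if "t \<in> {0..1}" for t
    proof -
      have "cmod (F (Complex t y)) \<le> M" using that \<rho> by (intro M(2) imageI) (auto simp: y_def in_cbox_complex_iff)
      moreover have "cmod (exp (- 2 * pi * \<i> * of_int k * Complex t y)) = exp (2 * pi * of_int k * y)"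
        by simp
      moreover have "exp (2 * pi * of_int k * y) = exp (- 2 * pi * \<rho>) ^ nat \<bar>k\<bar>"
        by (auto simp: y_def mult_ac simp flip: exp_of_nat_mult)
      ultimately show ?thesis unfolding g_def norm_mult by (simp add: mult_right_mono)
    qed
    have "((\<lambda>t. g (Complex t y)) has_integral c) (cbox 0 1)" using c[of y] \<rho> by (simp add: y_def)
    from has_integral_bound[OF _ this, of "M * exp (- 2 * pi * \<rho>) ^ nat \<bar>k\<bar>"] gb M(1)
    show ?thesis unfolding ck by simp
  qed
  with M(1) show thesis using that[of M] by simp
qed

lemma analytic_fourier_tail:
  assumes F: "F holomorphic_on {z. \<bar>Im z\<bar> < \<rho>0}" and \<rho>: "\<rho> < \<rho>0" "0 < \<rho>0"
    and f: "periodic1 f" "\<And>t. F (complex_of_real t) = f t"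
  obtains C where "\<And>n N. (\<Sum>k\<in>{- int N..int N} - {- int n..int n}. cmod (fourier_coeff f k)) \<le> C * exp (- \<rho> * real n)"
proof -
  \<comment> \<open>The prescribed rate may be zero or negative while the decay estimate needs a
    positive height; the midpoint is positive, below \<rho>0 and at least \<rho>.\<close>
  define r where "r = (max \<rho> 0 + \<rho>0) / 2"
  have r: "0 < r" "r < \<rho>0" "\<rho> \<le> r" using \<rho> by (auto simp: r_def)
  obtain M where M: "M \<ge> 0" "\<And>k. cmod (fourier_coeff f k) \<le> M * exp (- 2 * pi * r) ^ nat \<bar>k\<bar>"
    using analytic_fourier_decay[OF F r(1,2) f] by blast
  define q where "q = exp (- 2 * pi * r)"
  have q: "0 < q" "q < 1" using r(1) by (auto simp: q_def)
  have "(\<Sum>k\<in>{- int N..int N} - {- int n..int n}. cmod (fourier_coeff f k)) \<le> 2 * M / (1 - q) * exp (- \<rho> * real n)" for n N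
  proof -
    have "(\<Sum>k\<in>{- int N..int N} - {- int n..int n}. cmod (fourier_coeff f k))
        \<le> (\<Sum>k\<in>{- int N..int N} - {- int n..int n}. M * q ^ nat \<bar>k\<bar>)"
      using M(2) unfolding q_def by (intro sum_mono) auto
    also have "\<dots> = 2 * (\<Sum>k\<in>{n<..N}. M * q ^ k)" by (rule sum_symmetric_annulus)
    also have "\<dots> = 2 * M * (\<Sum>k\<in>{n<..N}. q ^ k)" by (simp add: sum_distrib_left mult.assoc)
    also have "\<dots> \<le> 2 * M * (q ^ n / (1 - q))"
    proof (intro mult_left_mono)
      have "(\<Sum>k\<in>{n<..N}. q ^ k) \<le> (\<Sum>k\<in>{n..N}. q ^ k)" using q by (intro sum_mono2) auto
      also have "\<dots> \<le> q ^ n / (1 - q)" using q by (auto simp: sum_gp divide_right_mono)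
      finally show "(\<Sum>k\<in>{n<..N}. q ^ k) \<le> q ^ n / (1 - q)" .
    qed (use M in simp)
    also have "\<dots> = 2 * M / (1 - q) * q ^ n" by simp
    also have "\<dots> \<le> 2 * M / (1 - q) * exp (- \<rho> * real n)"
    proof (intro mult_left_mono)
      have "q ^ n = exp (- (2 * pi * r) * real n)" unfolding q_def by (simp add: mult_ac flip: exp_of_nat_mult)
      moreover have "\<rho> \<le> 2 * pi * r" 
        using r pi_ge_two mult_right_mono[of 1 "2 * pi" r] by linarith
      then have "\<rho> * real n \<le> 2 * pi * r * real n" by (rule mult_right_mono) simp
      ultimately show "q ^ n \<le> exp (- \<rho> * real n)" by simp
    qed (use M q in simp)
    finally show ?thesis .
  qed
  then show thesis using that by blast
qed

section \<open>Best approximation and the error estimates\<close>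

text \<open>After division by the constant, the error is a lower bound of the set defining
  \<open>best_approx\<close>, so no minimizer is required. Periodicity makes f - p bounded, which
  ensures that \<open>sup_norm\<close> bounds it pointwise.\<close>

lemma quad_error_best_approx:
  assumes MZ: "MZ_family L x \<tau> A B" "n \<ge> 1" and f: "continuous_on UNIV f" "periodic1 f"
  shows "cmod (integral {-1/2..1/2} f - quad L x \<tau> n f) \<le> (1 + sqrt (B / A)) * best_approx n f"
proof -
  let ?e = "cmod (integral {-1/2..1/2} f - quad L x \<tau> n f)" and ?c = "1 + sqrt (B / A)"
  have c: "?c > 0" using MZ(1) by (simp add: MZ_family_def add_pos_nonneg)
  have "?e / ?c \<le> best_approx n f"
    unfolding best_approx_def
  proof (rule cInf_greatest)
    show "{sup_norm (\<lambda>t. f t - p t) |p. trig_poly n p} \<noteq> {}" using trig_poly_zero by blast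
    fix s assume "s \<in> {sup_norm (\<lambda>t. f t - p t) |p. trig_poly n p}"
    then obtain p where p: "trig_poly n p" and s: "s = sup_norm (\<lambda>t. f t - p t)" by blast
    have per: "periodic1 (\<lambda>t. f t - p t)" using f(2) trig_poly_plus_one[OF p] by (simp add: periodic1_def)
    have "continuous_on UNIV (\<lambda>t. f t - p t)"
      by (intro continuous_on_diff f(1) continuous_on_trig_poly[OF p])
    from periodic1_bounded[OF this per] obtain M where "\<And>t. cmod (f t - p t) \<le> M" by blast
    then have "bdd_above (range (\<lambda>t. cmod (f t - p t)))" 
      by (intro bdd_aboveI2[of _ _ M]) simp
    then have "cmod (f t - p t) \<le> s" for t unfolding s sup_norm_def by (auto intro: cSup_upper)
    from quad_error_le[OF MZ f(1) p this] c show "?e / ?c \<le> s" by (simp add: pos_divide_le_eq mult.commute)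
  qed
  then show ?thesis using c by (simp add: pos_divide_le_eq mult.commute)
qed

theorem theorem2p7:
  fixes L :: "nat \<Rightarrow> nat" and x \<tau> :: "nat \<Rightarrow> nat \<Rightarrow> real" and A B :: real
  assumes MZ: "MZ_family L x \<tau> A B"
  defines "\<kappa> \<equiv> B / A"
  shows
    "(\<forall>f. continuous_on UNIV f \<and> periodic1 f \<longrightarrow>
        (\<forall>n\<ge>1. cmod (integral {-1/2..1/2} f - quad L x \<tau> n f)
                  \<le> (1 + sqrt \<kappa>) * best_approx n f))
   \<and> (\<forall>\<sigma>\<ge>0. \<forall>f. C_sigma \<sigma> f \<longrightarrow>
        (\<lambda>n. cmod (integral {-1/2..1/2} f - quad L x \<tau> n f)) \<in> O(\<lambda>n. real n powr (- \<sigma>)))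
   \<and> (\<forall>\<sigma>>1/2. \<forall>f. continuous_on UNIV f \<and> periodic1 f \<and> in_H_sigma \<sigma> f \<longrightarrow>
        (\<forall>n\<ge>1. cmod (integral {-1/2..1/2} f - quad L x \<tau> n f)
                  \<le> (1 + sqrt \<kappa>) * H_sigma_norm \<sigma> f * phi_sigma \<sigma> n))
   \<and> (\<forall>\<rho>0 F f. 0 < \<rho>0 \<and> periodic1 f \<and> F holomorphic_on {z. \<bar>Im z\<bar> < \<rho>0}
          \<and> (\<forall>t. F (complex_of_real t) = f t) \<longrightarrow>
        (\<forall>\<rho><\<rho>0. (\<lambda>n. cmod (integral {-1/2..1/2} f - quad L x \<tau> n f))
                     \<in> O(\<lambda>n. exp (- \<rho> * real n))))"
proof (intro conjI allI impI)
  fix f and n :: nat assume "continuous_on UNIV f \<and> periodic1 f" "n \<ge> 1"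
  then show "cmod (integral {-1/2..1/2} f - quad L x \<tau> n f) \<le> (1 + sqrt \<kappa>) * best_approx n f"
    unfolding \<kappa>_def using quad_error_best_approx[OF MZ] by blast
next
  fix \<sigma> :: real and f assume "0 \<le> \<sigma>" "C_sigma \<sigma> f"
  then obtain C where C: "\<And>n. n \<ge> 1 \<Longrightarrow> \<exists>p. trig_poly n p \<and> (\<forall>t. cmod (f t - p t) \<le> C * real n powr (- \<sigma>))"
    and f: "continuous_on UNIV f" using C_sigma_trig_approx by blast
  have "cmod (integral {-1/2..1/2} f - quad L x \<tau> n f) \<le> (1 + sqrt (B / A)) * (C * real n powr (- \<sigma>))"
    if "n \<ge> 1" for n
    using C[OF that] quad_error_le[OF MZ that f] by blast
  then show "(\<lambda>n. cmod (integral {-1/2..1/2} f - quad L x \<tau> n f)) \<in> O(\<lambda>n. real n powr (- \<sigma>))"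
    \<comment> \<open>The Marcinkiewicz-Zygmund bounds begin at n = 1, so the estimate is asserted
      eventually.\<close>
    by (intro bigoI[of _ "(1 + sqrt (B / A)) * C"] eventually_mono[OF eventually_ge_at_top[of 1]])
       (simp add: mult.assoc)
next
  fix \<sigma> :: real and f and n :: nat
  assume "1/2 < \<sigma>" "continuous_on UNIV f \<and> periodic1 f \<and> in_H_sigma \<sigma> f" "1 \<le> n"
  then show "cmod (integral {-1/2..1/2} f - quad L x \<tau> n f) \<le> (1 + sqrt \<kappa>) * H_sigma_norm \<sigma> f * phi_sigma \<sigma> n"
    unfolding \<kappa>_def mult.assoc using quad_error_fourier_tail[OF MZ] H_sigma_fourier_tail by blast
next
  fix \<rho>0 \<rho> :: real and F f
  assume "0 < \<rho>0 \<and> periodic1 f \<and> F holomorphic_on {z. \<bar>Im z\<bar> < \<rho>0} \<and> (\<forall>t. F (complex_of_real t) = f t)"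
    and \<rho>: "\<rho> < \<rho>0"
  then have \<rho>0: "0 < \<rho>0" and f: "periodic1 f" "\<And>t. F (complex_of_real t) = f t"
    and F: "F holomorphic_on {z. \<bar>Im z\<bar> < \<rho>0}" by auto
  have "continuous_on UNIV (\<lambda>t. F (complex_of_real t))"
    by (rule continuous_on_compose2[OF holomorphic_on_imp_continuous_on[OF F]])
       (use \<rho>0 in \<open>auto intro!: continuous_intros\<close>)
  then have cf: "continuous_on UNIV f" unfolding f(2) by simp
  obtain C where C: "\<And>n N. (\<Sum>k\<in>{- int N..int N} - {- int n..int n}. cmod (fourier_coeff f k)) \<le> C * exp (- \<rho> * real n)"
    using analytic_fourier_tail[OF F \<rho> \<rho>0 f] by blast
  have "cmod (integral {-1/2..1/2} f - quad L x \<tau> n f) \<le> (1 + sqrt (B / A)) * (C * exp (- \<rho> * real n))"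
    if "n \<ge> 1" for n
    using quad_error_fourier_tail[OF MZ that cf f(1) C] .
  then show "(\<lambda>n. cmod (integral {-1/2..1/2} f - quad L x \<tau> n f)) \<in> O(\<lambda>n. exp (- \<rho> * real n))"
    by (intro bigoI[of _ "(1 + sqrt (B / A)) * C"] eventually_mono[OF eventually_ge_at_top[of 1]])
       (simp add: mult.assoc)
qed

end
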